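(* Let $a\in L^1(I)$ and $\lambda\in\mathbb{R}$. If $L[\lambda]$ is nonresonant in $X_P$ and in $X_{M_2}$, then for all $(t,s)\in I\times I$ $$G_{M_2}[\lambda](t,s)=G_P[\lambda](t,s)-r_3[\lambda](t)\,G_{M_2}[\lambda](1,s)+r_4[\lambda](t)\,\frac{\partial}{\partial t}G_{M_2}[\lambda](0,s)$$ $$=G_P[\lambda](t,s)+\frac{\partial}{\partial s}G_P[\lambda](t,0)\,G_{M_2}[\lambda](1,s)+G_P[\lambda](t,0)\,\frac{\partial}{\partial t}G_{M_2}[\lambda](0,s).$$
   Context: $I=[0,1]$, $a\in L^1(I)$ is real-valued, $\lambda\in\mathbb{R}$, and $L[\lambda]u(t)=u''(t)+(a(t)+\lambda)u(t)$. $W^{2,1}(I)=\{u\in C(I):u'\in AC(I)\}$, where $AC(I)$ is the set of absolutely continuous functions on $I$. $X_P=\{u\in W^{2,1}(I):u(0)=u(1),\,u'(0)=u'(1)\}$ (periodic) and $X_{M_2}=\{u\in W^{2,1}(I):u(0)=u'(1)=0\}$ (Mixed 2). $L[\lambda]$ is nonresonant in $X$ if $u=0$ is the only $u\in X$ with $L[\lambda]u=0$ a.e. on $I$. In that case, for every $\sigma\in L^1(I)$ the problem $L[\lambda]u=\sigma$ a.e. on $I$, $u\in X$, has a unique solution, given by $u(t)=\int_0^1G(t,s)\sigma(s)\,ds$, where the continuous function $G:I\times I\to\mathbb{R}$ is the Green's function; it is denoted $G_P[\lambda]$ for $X=X_P$ and $G_{M_2}[\lambda]$ for $X=X_{M_2}$.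 $r_3[\lambda]$ is the unique solution of $L[\lambda]u=0$ a.e. on $I$, $u(0)-u(1)=1$, $u'(0)-u'(1)=0$; $r_4[\lambda]$ is the unique solution of $L[\lambda]u=0$ a.e. on $I$, $u(0)-u(1)=0$, $u'(0)-u'(1)=1$. Convention: $\frac{\partial}{\partial s}G(t,0)$ is the (one-sided) derivative in the second variable for $t\in(0,1)$, extended by continuity to $t\in\{0,1\}$; $\frac{\partial}{\partial t}G(0,s)$ is the one-sided derivative in the first variable at $t=0$ for $s\in(0,1)$, extended by continuity to $s\in\{0,1\}$. *)

theory Defs
  imports "HOL-Analysis.Analysis"
begin

text \<open>
  A function on \<open>I = [0,1]\<close> is a total function on the reals of which only the values on
  \<open>{0..1}\<close> matter. Every derivative is taken within \<open>{0..1}\<close>, hence is one-sided at 0 and 1.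
\<close>

definition AC_on :: "real set \<Rightarrow> (real \<Rightarrow> real) set" where
  "AC_on S = {f. \<forall>\<epsilon>>0. \<exists>\<delta>>0. \<forall>d T. d division_of T \<longrightarrow> T \<subseteq> S \<longrightarrow> (\<Sum>k\<in>d. Sup k - Inf k) < \<delta> \<longrightarrow>
     (\<Sum>k\<in>d. \<bar>f (Sup k) - f (Inf k)\<bar>) < \<epsilon>}"

definition D :: "(real \<Rightarrow> real) \<Rightarrow> real \<Rightarrow> real" where
  "D u t = vector_derivative u (at t within {0..1})"

definition W21 :: "(real \<Rightarrow> real) set" where
  "W21 = {u. continuous_on {0..1} u \<and> u differentiable_on {0..1} \<and> D u \<in> AC_on {0..1}}"

definition X_P :: "(real \<Rightarrow> real) set" where
  "X_P = {u \<in> W21. u 0 = u 1 \<and> D u 0 = D u 1}"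

definition X_M2 :: "(real \<Rightarrow> real) set" where
  "X_M2 = {u \<in> W21. u 0 = 0 \<and> D u 1 = 0}"

text \<open>
  \<open>L[\<lambda>] u = \<sigma>\<close> almost everywhere on \<open>I\<close>; the second derivative is \<open>d\<close>, and its existence
  at almost every point is part of the condition (it is automatic for \<open>u \<in> W21\<close>).
\<close>

definition solves :: "(real \<Rightarrow> real) \<Rightarrow> real \<Rightarrow> (real \<Rightarrow> real) \<Rightarrow> (real \<Rightarrow> real) \<Rightarrow> bool" where
  "solves a lam \<sigma> u \<longleftrightarrow> (AE t in lebesgue_on {0..1}.
     \<exists>d. (D u has_real_derivative d) (at t within {0..1}) \<and> d + (a t + lam) * u t = \<sigma> t)"

definition nonresonant :: "(real \<Rightarrow> real) \<Rightarrow> real \<Rightarrow> (real \<Rightarrow> real) set \<Rightarrow> bool" where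
  "nonresonant a lam X \<longleftrightarrow> (\<forall>u\<in>X. solves a lam (\<lambda>_. 0) u \<longrightarrow> (\<forall>t\<in>{0..1}. u t = 0))"

definition is_green ::
  "(real \<Rightarrow> real) \<Rightarrow> real \<Rightarrow> (real \<Rightarrow> real) set \<Rightarrow> (real \<Rightarrow> real \<Rightarrow> real) \<Rightarrow> bool" where
  "is_green a lam X G \<longleftrightarrow> continuous_on ({0..1} \<times> {0..1}) (\<lambda>(t, s). G t s) \<and>
     (\<forall>\<sigma>. integrable (lebesgue_on {0..1}) \<sigma> \<longrightarrow>
        (\<forall>u. u \<in> X \<and> solves a lam \<sigma> u \<longleftrightarrow>
          (\<forall>t\<in>{0..1}. u t = integral\<^sup>L (lebesgue_on {0..1}) (\<lambda>s. G t s * \<sigma> s))))"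

text \<open>
  The choice operators below select objects that are unique on \<open>I \<times> I\<close>, respectively on \<open>I\<close>
  (but not outside) in the nonresonant case.
\<close>

definition green :: "(real \<Rightarrow> real) set \<Rightarrow> (real \<Rightarrow> real) \<Rightarrow> real \<Rightarrow> real \<Rightarrow> real \<Rightarrow> real" where
  "green X a lam = (SOME G. is_green a lam X G)"

abbreviation G_P :: "(real \<Rightarrow> real) \<Rightarrow> real \<Rightarrow> real \<Rightarrow> real \<Rightarrow> real" where
  "G_P \<equiv> green X_P"

abbreviation G_M2 :: "(real \<Rightarrow> real) \<Rightarrow> real \<Rightarrow> real \<Rightarrow> real \<Rightarrow> real" where
  "G_M2 \<equiv> green X_M2"

definition r3 :: "(real \<Rightarrow> real) \<Rightarrow> real \<Rightarrow> real \<Rightarrow> real" where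
  "r3 a lam = (SOME u. u \<in> W21 \<and> solves a lam (\<lambda>_. 0) u \<and> u 0 - u 1 = 1 \<and> D u 0 - D u 1 = 0)"

definition r4 :: "(real \<Rightarrow> real) \<Rightarrow> real \<Rightarrow> real \<Rightarrow> real" where
  "r4 a lam = (SOME u. u \<in> W21 \<and> solves a lam (\<lambda>_. 0) u \<and> u 0 - u 1 = 0 \<and> D u 0 - D u 1 = 1)"

text \<open>\<open>g\<close> on the open interval, extended by continuity to the endpoints.\<close>

definition extend :: "(real \<Rightarrow> real) \<Rightarrow> real \<Rightarrow> real" where
  "extend g x = (if x \<in> {0<..<1} then g x else Lim (at x within {0<..<1}) g)"

definition ds0 :: "(real \<Rightarrow> real \<Rightarrow> real) \<Rightarrow> real \<Rightarrow> real" where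
  "ds0 G = extend (\<lambda>t. D (\<lambda>s. G t s) 0)"

definition dt0 :: "(real \<Rightarrow> real \<Rightarrow> real) \<Rightarrow> real \<Rightarrow> real" where
  "dt0 G = extend (\<lambda>s. D (\<lambda>t. G t s) 0)"

end

theory Submission
  imports Defs
begin

text \<open>
  For fixed \<open>s\<close> in the open interval, the difference of the two Green's functions \<open>G_M2(\<cdot>, s)\<close> and
  \<open>G_P(\<cdot>, s)\<close> solves the homogeneous equation, because their singularities on the diagonal cancel. By
  nonresonance in \<open>X_P\<close>, a homogeneous solution is a combination of \<open>r3\<close> and \<open>r4\<close> whose coefficients
  are its jumps in value and in derivative, taken at 0 minus at 1 (\<open>homogeneous_eq_jumps\<close>). The periodic
  function \<open>G_P(\<cdot>, s)\<close> has no jumps, and the mixed boundary conditions reduce those of \<open>G_M2(\<cdot>, s)\<close> to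
  \<open>- G_M2(1, s)\<close> and \<open>\<partial>\<^sub>t G_M2(0, s)\<close>. This is the first formula. The second one follows from
  \<open>\<partial>\<^sub>s G_P(t, 0) = - r3(t)\<close> and \<open>G_P(t, 0) = r4(t)\<close>.

  As Green's functions are chosen by a description that determines them on \<open>I \<times> I\<close> only, they are
  first computed. In terms of the fundamental solutions \<open>\<phi>\<close>, \<open>\<psi>\<close> and the Cauchy
  function \<open>K(t, s) = \<psi>(t) \<phi>(s) - \<phi>(t) \<psi>(s)\<close>, cut off to \<open>s \<le> t\<close>, they are
  \<open>G_P = K + r3 K(1, \<cdot>) + r4 \<partial>\<^sub>t K(1, \<cdot>)\<close> and \<open>G_M2 = K - \<psi> \<partial>\<^sub>t K(1, \<cdot>) / \<psi>'(1)\<close>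
  (\<open>G_P_eq\<close>, \<open>G_M2_eq\<close>). From these formulas the boundary derivatives can be read off, and the
  identity itself is the decomposition of \<open>\<psi>\<close> by its jumps, also when \<open>s\<close> is an endpoint.

  The analytic work goes into the equation with an \<open>L\<^sup>1\<close> coefficient, whose solutions satisfy it almost
  everywhere only. Three facts about absolutely continuous functions carry it: indefinite
  integrals are differentiable almost everywhere (\<open>indefinite_integral_has_derivative_ae\<close>) and
  absolutely continuous (\<open>indefinite_integral_AC_on\<close>), and an absolutely continuous function
  with vanishing derivative almost everywhere is constant (\<open>AC_on_deriv_zero_ae_const\<close>). They reduce the
  equation to integral equations, which have a product rule (\<open>primitive_mult\<close>, used for the Wronskian and
  for variation of parameters) and are solved by a contraction argument (\<open>volterra_fixed_point\<close>).
\<close>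

section \<open>Absolutely continuous functions and indefinite integrals\<close>

lemma indefinite_integral_diff:
  fixes f :: "real \<Rightarrow> real"
  assumes "f integrable_on {a..b}" "a \<le> x" "x \<le> y" "y \<le> b"
  shows "integral {a..y} f - integral {a..x} f = integral {x..y} f"
proof -
  have "f integrable_on {a..y}"
    using assms by (auto intro: integrable_subinterval_real)
  from Henstock_Kurzweil_Integration.integral_combine[OF assms(2,3) this] show ?thesis by simp
qed

lemma lmeasurable_Un_negligible:
  assumes "U \<in> lmeasurable" "negligible N"
  shows "U \<union> N \<in> lmeasurable" "measure lebesgue (U \<union> N) = measure lebesgue U"
proof -
  show "U \<union> N \<in> lmeasurable"
    using assms by (simp add: fmeasurable.Un negligible_imp_measurable)
  have "N \<in> null_sets lebesgue" using assms(2) by (simp add: negligible_iff_null_sets)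
  then show "measure lebesgue (U \<union> N) = measure lebesgue U"
    using assms(1) by (intro measure_Un_null_set fmeasurableD)
qed

text \<open>
  The Lebesgue differentiation theorem in one dimension, at a fixed tolerance \<open>e\<close>. Every bad point
  \<open>x\<close> has arbitrarily short intervals \<open>[x, y]\<close> (or \<open>[y, x]\<close>) on which the integral of \<open>f\<close> and the
  Riemann term \<open>f x * (y - x)\<close> differ by more than \<open>e\<close> times the length. By Vitali's theorem countably
  many disjoint such intervals cover almost all bad points. Any finite selection of them, each tagged
  at its bad endpoint, is a fine partial division, so Henstock's lemma bounds the sum of
  those differences, and hence \<open>e\<close> times the total length, by an arbitrarily small number.
\<close>

lemma indefinite_integral_deviation_negligible:
  fixes f :: "real \<Rightarrow> real"
  assumes f: "f integrable_on {a..b}" and e: "e > 0"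
  shows "negligible {x \<in> {a..b}. \<forall>d>0. \<exists>y\<in>{a..b}. \<bar>y - x\<bar> < d \<and>
           \<bar>integral {a..y} f - integral {a..x} f - f x * (y - x)\<bar> > e * \<bar>y - x\<bar>}"
    (is "negligible ?E")
  unfolding negligible_outer_le
proof (intro allI impI)
  fix \<epsilon> :: real assume "\<epsilon> > 0"
  define F where "F = (\<lambda>x. integral {a..x} f)"
  have "f integrable_on cbox a b" "e * \<epsilon> > 0" using f e \<open>\<epsilon> > 0\<close> by auto
  then obtain \<gamma> where \<gamma>: "gauge \<gamma>"
    and H: "\<And>p. p tagged_partial_division_of (cbox a b) \<Longrightarrow> \<gamma> fine p \<Longrightarrow>
             (\<Sum>(x,k)\<in>p. norm (measure lborel k *\<^sub>R f x - integral k f)) < e * \<epsilon>"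
    by (rule Henstock_lemma) blast
  \<comment> \<open>Intervals with a bad endpoint, as pairs of the bad endpoint and the other one; they are
    written as balls below because Vitali's theorem is about balls.\<close>
  define K where "K = {(x, y). x \<in> {a..b} \<and> y \<in> {a..b} \<and> x \<noteq> y \<and> cball ((x + y) / 2) (\<bar>y - x\<bar> / 2) \<subseteq> \<gamma> x
       \<and> \<bar>F y - F x - f x * (y - x)\<bar> > e * \<bar>y - x\<bar>}"
  let ?B = "\<lambda>i::real \<times> real. cball ((fst i + snd i) / 2) (\<bar>snd i - fst i\<bar> / 2)"
  have ball_eq: "?B i = {min (fst i) (snd i)..max (fst i) (snd i)}" for i
    by (auto simp: cball_eq_atLeastAtMost min_def max_def field_simps)
  obtain C where C: "countable C" "C \<subseteq> K" "pairwise (\<lambda>i j. disjnt (?B i) (?B j)) C"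
    "negligible (?E - (\<Union>i\<in>C. ?B i))"
  proof (rule Vitali_covering_theorem_cballs[of K "\<lambda>i. \<bar>snd i - fst i\<bar> / 2" ?E "\<lambda>i. (fst i + snd i) / 2"])
    show "0 < \<bar>snd i - fst i\<bar> / 2" if "i \<in> K" for i
      using that by (auto simp: K_def)
    show "\<exists>i. i \<in> K \<and> x \<in> ?B i \<and> \<bar>snd i - fst i\<bar> / 2 < d" if x: "x \<in> ?E" and d: "d > 0" for x d
    proof -
      have "open (\<gamma> x)" "x \<in> \<gamma> x" using \<gamma> by (auto simp: gauge_def)
      then obtain r where r: "r > 0" "ball x r \<subseteq> \<gamma> x" by (meson openE)
      have "min r d > 0" using r d by auto
      then obtain y where y: "y \<in> {a..b}" "\<bar>y - x\<bar> < min r d" "\<bar>F y - F x - f x * (y - x)\<bar> > e * \<bar>y - x\<bar>"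
        using x unfolding F_def by blast
      have "x \<noteq> y" using y(3) by auto
      have "?B (x, y) \<subseteq> ball x r" using y(2) unfolding ball_eq by (auto simp: dist_real_def)
      then have "(x, y) \<in> K" using x y r \<open>x \<noteq> y\<close> by (auto simp: K_def)
      moreover have "x \<in> ?B (x, y)" unfolding ball_eq by auto
      ultimately show ?thesis using y(2) by (intro exI[of _ "(x, y)"]) auto
    qed
  qed auto
  have bound: "measure lebesgue (\<Union>i\<in>C'. ?B i) \<le> \<epsilon>" if C': "C' \<subseteq> C" "finite C'" for C'
  proof -
    let ?p = "(\<lambda>i. (fst i, ?B i)) ` C'"
    have dj: "disjnt (?B i) (?B j)" if "i \<in> C'" "j \<in> C'" "i \<noteq> j" for i j
      using that C(3) C' by (meson pairwiseD subsetD)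
    have ne: "?B i \<noteq> {}" for i by simp
    have inj: "inj_on ?B C'"
      using dj ne by (intro inj_onI) (metis disjnt_self_iff_empty)
    have pt: "?p tagged_partial_division_of cbox a b"
      unfolding tagged_partial_division_of_def
    proof (intro conjI allI impI)
      show "finite ?p" using C' by simp
    next
      fix x k assume "(x, k) \<in> ?p"
      then obtain i where i: "i \<in> C'" "x = fst i" "k = ?B i" by auto
      have "i \<in> K" using i C C' by blast
      show "x \<in> k" unfolding i(2,3) ball_eq by auto
      show "k \<subseteq> cbox a b" using \<open>i \<in> K\<close> unfolding i(2,3) ball_eq by (auto simp: K_def)
      show "\<exists>a b. k = cbox a b" unfolding i ball_eq by (metis interval_cbox)
    next
      fix x1 k1 x2 k2 assume *: "(x1, k1) \<in> ?p \<and> (x2, k2) \<in> ?p \<and> (x1, k1) \<noteq> (x2, k2)"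
      then obtain i j where "i \<in> C'" "j \<in> C'" "k1 = ?B i" "k2 = ?B j" "i \<noteq> j" by auto
      then have "k1 \<inter> k2 = {}" using dj[of i j] by (auto simp: disjnt_def)
      then show "interior k1 \<inter> interior k2 = {}" using interior_subset by blast
    qed
    have fine: "\<gamma> fine ?p"
    proof (unfold fine_def, clarify)
      fix x y assume "(x, y) \<in> C'"
      then have "(x, y) \<in> K" using C(2) C' by blast
      then show "z \<in> \<gamma> (fst (x, y))" if "z \<in> ?B (x, y)" for z
        using that by (auto simp: K_def simp del: mem_cball)
    qed
    have "e * measure lebesgue (\<Union>i\<in>C'. ?B i) = e * (\<Sum>i\<in>C'. measure lebesgue (?B i))"
      using measure_UNION'[OF C'(2), of ?B lebesgue] dj by (simp add: pairwise_def)
    also have "\<dots> = (\<Sum>i\<in>C'. e * measure lborel (?B i))"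
      by (simp add: sum_distrib_left)
    also have "\<dots> \<le> (\<Sum>i\<in>C'. norm (measure lborel (?B i) *\<^sub>R f (fst i) - integral (?B i) f))"
    proof (rule sum_mono)
      fix i assume "i \<in> C'"
      then have "i \<in> K" using C C' by blast
      obtain x y where i: "i = (x, y)" by fastforce
      have xy: "x \<in> {a..b}" "y \<in> {a..b}" "x \<noteq> y" "\<bar>F y - F x - f x * (y - x)\<bar> > e * \<bar>y - x\<bar>"
        using \<open>i \<in> K\<close> by (auto simp: K_def i)
      show "e * measure lborel (?B i) \<le> norm (measure lborel (?B i) *\<^sub>R f (fst i) - integral (?B i) f)"
      proof (cases "x < y")
        case True
        then show ?thesis using xy indefinite_integral_diff[OF f, of x y]
          unfolding ball_eq i F_def by (auto simp: min_def max_def algebra_simps abs_minus_commute)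
      next
        case False
        then show ?thesis using xy indefinite_integral_diff[OF f, of y x]
          unfolding ball_eq i F_def by (auto simp: min_def max_def algebra_simps abs_minus_commute)
      qed
    qed
    also have "\<dots> = (\<Sum>(x,k)\<in>?p. norm (measure lborel k *\<^sub>R f x - integral k f))"
    proof (subst sum.reindex)
      show "inj_on (\<lambda>i. (fst i, ?B i)) C'" using inj by (auto simp: inj_on_def)
    qed auto
    also have "\<dots> < e * \<epsilon>" by (rule H[OF pt fine])
    finally show ?thesis using e by auto
  qed
  let ?U = "\<Union>i\<in>C. ?B i"
  have U: "?U \<in> lmeasurable" "measure lebesgue ?U \<le> \<epsilon>"
    using fmeasurable_UN_bound[OF C(1), of ?B lebesgue \<epsilon>] measure_UN_bound[OF C(1), of ?B lebesgue \<epsilon>] bound by auto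
  have "?U \<union> (?E - ?U) \<in> lmeasurable" "measure lebesgue (?U \<union> (?E - ?U)) = measure lebesgue ?U"
    using lmeasurable_Un_negligible[OF U(1) C(4)] by auto
  then show "\<exists>T. ?E \<subseteq> T \<and> T \<in> lmeasurable \<and> measure lebesgue T \<le> \<epsilon>"
    using U by (intro exI[of _ "?U \<union> (?E - ?U)"]) auto
qed

lemma indefinite_integral_has_derivative_ae:
  fixes f :: "real \<Rightarrow> real"
  assumes f: "f integrable_on {a..b}"
  shows "negligible {x \<in> {a..b}.
    \<not> ((\<lambda>x. integral {a..x} f) has_real_derivative f x) (at x within {a..b})}"
proof -
  let ?E = "\<lambda>e. {x \<in> {a..b}. \<forall>d>0. \<exists>y\<in>{a..b}. \<bar>y - x\<bar> < d \<and>
           \<bar>integral {a..y} f - integral {a..x} f - f x * (y - x)\<bar> > e * \<bar>y - x\<bar>}"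
  have "x \<in> (\<Union>n. ?E (inverse (real (Suc n))))"
    if x: "x \<in> {a..b}" and nd: "\<not> ((\<lambda>x. integral {a..x} f) has_real_derivative f x) (at x within {a..b})" for x
  proof -
    from nd obtain e where e: "e > 0" and
      bad: "\<forall>d>0. \<exists>y\<in>{a..b}. \<bar>y - x\<bar> < d \<and>
           \<bar>integral {a..y} f - integral {a..x} f - f x * (y - x)\<bar> > e * \<bar>y - x\<bar>"
      unfolding has_field_derivative_def has_derivative_within_alt
      by (auto simp: bounded_linear_mult_right not_le)
    obtain n where n: "inverse (real (Suc n)) < e" using reals_Archimedean[OF e] by blast
    have "x \<in> ?E (inverse (real (Suc n)))"
    proof (intro CollectI conjI allI impI x)
      fix d :: real assume "d > 0"
      then obtain y where y: "y \<in> {a..b}" "\<bar>y - x\<bar> < d"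
        "\<bar>integral {a..y} f - integral {a..x} f - f x * (y - x)\<bar> > e * \<bar>y - x\<bar>" using bad by blast
      have "inverse (real (Suc n)) * \<bar>y - x\<bar> \<le> e * \<bar>y - x\<bar>" using n by (intro mult_right_mono) auto
      with y show "\<exists>y\<in>{a..b}. \<bar>y - x\<bar> < d \<and> 
        \<bar>integral {a..y} f - integral {a..x} f - f x * (y - x)\<bar> > inverse (real (Suc n)) * \<bar>y - x\<bar>"
        by (intro bexI[of _ y]) linarith+
    qed
    then show ?thesis by blast
  qed
  then have "{x \<in> {a..b}. \<not> ((\<lambda>x. integral {a..x} f) has_real_derivative f x) (at x within {a..b})}
     \<subseteq> (\<Union>n. ?E (inverse (real (Suc n))))" by blast
  moreover have "negligible (\<Union>n. ?E (inverse (real (Suc n))))"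
  proof (rule negligible_countable_Union)
    show "negligible S" if "S \<in> range (\<lambda>n. ?E (inverse (real (Suc n))))" for S
      using that indefinite_integral_deviation_negligible[OF f] by (auto simp del: of_nat_Suc)
  qed simp
  ultimately show ?thesis by (rule negligible_subset[rotated])
qed

lemma division_interval:
  fixes k :: "real set"
  assumes "d division_of T" "k \<in> d" "T \<subseteq> {a..b}"
  shows "{Inf k..Sup k} = k" "a \<le> Inf k" "Inf k \<le> Sup k" "Sup k \<le> b"
proof -
  obtain u v where k: "k = cbox u v" using division_ofD(4)[OF assms(1,2)] by blast
  have "k \<noteq> {}" "k \<subseteq> T" using division_ofD[OF assms(1)] assms(2) by auto
  then have "u \<le> v" using k by auto
  then have s: "Inf k = u" "Sup k = v" using k by auto
  then show "{Inf k..Sup k} = k" "Inf k \<le> Sup k" using k \<open>u \<le> v\<close> by auto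
  have "u \<in> {a..b}" "v \<in> {a..b}" using \<open>k \<subseteq> T\<close> assms(3) k \<open>u \<le> v\<close>
    by (metis (full_types) atLeastAtMost_iff box_real(2) order_refl subset_iff)+
  then show "a \<le> Inf k" "Sup k \<le> b" using s by auto
qed

text \<open>
  Cutting \<open>\<bar>f\<bar>\<close> off at a high level changes its integral little. This splits an integrable function
  into a bounded part, whose integral over a set is controlled by the length of the set, and a part
  with small integral; that is why indefinite integrals are absolutely continuous.
\<close>

lemma truncation_error_small:
  fixes f :: "real \<Rightarrow> real"
  assumes f: "f absolutely_integrable_on {a..b}" and "e > 0"
  obtains n :: nat where "(\<lambda>x. \<bar>f x\<bar> - min \<bar>f x\<bar> (real n)) integrable_on {a..b}"
    "integral {a..b} (\<lambda>x. \<bar>f x\<bar> - min \<bar>f x\<bar> (real n)) < e"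
proof -
  let ?g = "\<lambda>n x. \<bar>f x\<bar> - min \<bar>f x\<bar> (real n)"
  have af: "(\<lambda>x. \<bar>f x\<bar>) absolutely_integrable_on {a..b}"
    using absolutely_integrable_norm[OF f] by (simp add: o_def)
  have min: "(\<lambda>x. min \<bar>f x\<bar> (real n)) absolutely_integrable_on {a..b}" for n
    by (rule absolutely_integrable_min_1[OF af]) (simp add: absolutely_integrable_continuous_real)
  have int: "?g n integrable_on {a..b}" for n
    using set_lebesgue_integral_eq_integral(1)[OF set_integral_diff(1)[OF af min]] .
  have "(\<lambda>n. integral {a..b} (?g n)) \<longlonglongrightarrow> integral {a..b} (\<lambda>x. 0::real)"
  proof (rule dominated_convergence(2)[where h = "\<lambda>x. \<bar>f x\<bar>"])
    show "?g n integrable_on {a..b}" for n by (rule int)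
    show "(\<lambda>x. \<bar>f x\<bar>) integrable_on {a..b}" using af by (rule set_lebesgue_integral_eq_integral(1))
    show "norm (?g n x) \<le> \<bar>f x\<bar>" for n x by auto
    show "(\<lambda>n. ?g n x) \<longlonglongrightarrow> 0" for x
    proof (rule tendsto_eventually)
      obtain N :: nat where "\<bar>f x\<bar> \<le> real N" using real_arch_simple by blast
      then show "\<forall>\<^sub>F n in sequentially. ?g n x = 0"
        by (intro eventually_sequentiallyI[of N]) (auto simp: min_def)
    qed
  qed
  then have "\<forall>\<^sub>F n in sequentially. integral {a..b} (?g n) < e"
    using \<open>e > 0\<close> by (intro order_tendstoD(2)) auto
  then obtain n where "integral {a..b} (?g n) < e" by (auto simp: eventually_sequentially)
  with int that show ?thesis by blast
qed

lemma indefinite_integral_AC_on: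
  fixes f :: "real \<Rightarrow> real"
  assumes f: "f absolutely_integrable_on {a..b}"
  shows "(\<lambda>x. integral {a..x} f) \<in> AC_on {a..b}"
  unfolding AC_on_def
proof (intro CollectI allI impI)
  fix \<epsilon> :: real assume "\<epsilon> > 0"
  let ?F = "\<lambda>x. integral {a..x} f"
  have fi: "f integrable_on {a..b}" and af: "(\<lambda>x. \<bar>f x\<bar>) integrable_on {a..b}"
    using f by (auto simp: absolutely_integrable_on_def)
  obtain n :: nat where n: "(\<lambda>x. \<bar>f x\<bar> - min \<bar>f x\<bar> (real n)) integrable_on {a..b}"
    "integral {a..b} (\<lambda>x. \<bar>f x\<bar> - min \<bar>f x\<bar> (real n)) < \<epsilon> / 2"
    using truncation_error_small[OF f, of "\<epsilon> / 2"] \<open>\<epsilon> > 0\<close> by auto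
  define g where "g = (\<lambda>x. \<bar>f x\<bar> - min \<bar>f x\<bar> (real n))"
  have g0: "g x \<ge> 0" for x by (auto simp: g_def)
  show "\<exists>\<delta>>0. \<forall>d T. d division_of T \<longrightarrow> T \<subseteq> {a..b} \<longrightarrow> (\<Sum>k\<in>d. Sup k - Inf k) < \<delta> \<longrightarrow>
     (\<Sum>k\<in>d. \<bar>?F (Sup k) - ?F (Inf k)\<bar>) < \<epsilon>"
  proof (intro exI[of _ "\<epsilon> / (2 * (real n + 1))"] conjI allI impI)
    show "0 < \<epsilon> / (2 * (real n + 1))" using \<open>\<epsilon> > 0\<close> by simp
    fix d T assume d: "d division_of T" "T \<subseteq> {a..b}" and len: "(\<Sum>k\<in>d. Sup k - Inf k) < \<epsilon> / (2 * (real n + 1))"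
    have gk: "g integrable_on k" if "k \<in> d" for k
    proof -
      note k = division_interval[OF d(1) that d(2)]
      have "g integrable_on {Inf k..Sup k}"
        using k(2-4) n(1) unfolding g_def by (auto intro: integrable_subinterval_real)
      then show ?thesis by (subst (asm) k(1))
    qed
    have gT: "g integrable_on T" and sumT: "integral T g = (\<Sum>k\<in>d. integral k g)"
      using integrable_combine_division[OF d(1)] integral_combine_division_bottomup[OF d(1)] gk by auto
    have "(\<Sum>k\<in>d. \<bar>?F (Sup k) - ?F (Inf k)\<bar>) \<le> (\<Sum>k\<in>d. integral k g + real n * (Sup k - Inf k))"
    proof (rule sum_mono)
      fix k assume "k \<in> d"
      note k = division_interval[OF d(1) this d(2)]
      have sub: "{Inf k..Sup k} \<subseteq> {a..b}" using k(2,4) by simp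
      have "\<bar>?F (Sup k) - ?F (Inf k)\<bar> = \<bar>integral {Inf k..Sup k} f\<bar>"
        using indefinite_integral_diff[OF fi k(2,3,4)] by simp
      also have "\<dots> \<le> integral {Inf k..Sup k} (\<lambda>x. \<bar>f x\<bar>)"
        using integral_norm_bound_integral[of f "{Inf k..Sup k}" "\<lambda>x. \<bar>f x\<bar>"]
          integrable_subinterval_real[OF fi sub] integrable_subinterval_real[OF af sub] by simp
      also have "\<dots> \<le> integral {Inf k..Sup k} (\<lambda>x. g x + real n)"
        unfolding k(1)
      proof (intro integral_le integrable_add)
        show "(\<lambda>x. \<bar>f x\<bar>) integrable_on k" using integrable_subinterval_real[OF af sub] unfolding k(1) .
        show "(\<lambda>x. real n) integrable_on k" by (metis k(1) integrable_const_ivl)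
      qed (use gk[OF \<open>k \<in> d\<close>] in \<open>auto simp: g_def\<close>)
      also have "\<dots> = integral k g + real n * (Sup k - Inf k)"
      proof -
        have "(\<lambda>x. real n) integrable_on {Inf k..Sup k}" "g integrable_on {Inf k..Sup k}"
          using gk[OF \<open>k \<in> d\<close>] by (simp_all only: k(1)) (metis k(1) integrable_const_ivl)
        then have "integral {Inf k..Sup k} (\<lambda>x. g x + real n) = integral {Inf k..Sup k} g + real n * (Sup k - Inf k)"
          using k(3) by (subst integral_add) auto
        then show ?thesis by (simp only: k(1))
      qed
      finally show "\<bar>?F (Sup k) - ?F (Inf k)\<bar> \<le> integral k g + real n * (Sup k - Inf k)" .
    qed
    also have "\<dots> = integral T g + real n * (\<Sum>k\<in>d. Sup k - Inf k)"
      by (simp add: sum.distrib sumT sum_distrib_left)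
    also have "integral T g \<le> integral {a..b} g"
      using n(1) gT g0 d by (intro integral_subset_le) (auto simp: g_def)
    also have "integral {a..b} g < \<epsilon> / 2" using n(2) by (simp add: g_def)
    also have "real n * (\<Sum>k\<in>d. Sup k - Inf k) \<le> real n * (\<epsilon> / (2 * (real n + 1)))"
      using len by (intro mult_left_mono) auto
    also have "\<dots> \<le> \<epsilon> / 2" using \<open>\<epsilon> > 0\<close> by (simp add: field_simps)
    finally show "(\<Sum>k\<in>d. \<bar>?F (Sup k) - ?F (Inf k)\<bar>) < \<epsilon>" by simp
  qed
qed

text \<open>
  Cousin's lemma gives a tagged division of \<open>[a, c]\<close> that is fine for the following gauge. At a tag with
  derivative 0 the cell is so short that \<open>f\<close> varies over it by at most \<open>\<epsilon>\<close> times its length; at a tag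
  in the exceptional set \<open>N\<close> the cell lies in an open set \<open>U\<close> around \<open>N\<close> of measure below the \<open>\<delta>\<close> of
  absolute continuity, so all these cells together contribute at most \<open>\<epsilon>\<close>.
\<close>

lemma AC_on_deriv_zero_ae_const:
  fixes f :: "real \<Rightarrow> real"
  assumes AC: "f \<in> AC_on {a..b}" and N: "negligible N"
    and deriv: "\<And>x. x \<in> {a..b} - N \<Longrightarrow> (f has_real_derivative 0) (at x within {a..b})"
    and c: "c \<in> {a..b}"
  shows "f c = f a"
proof -
  have ac: "a \<le> c" using c by auto
  have "\<bar>f c - f a\<bar> \<le> \<epsilon> * (c - a + 1)" if e: "\<epsilon> > 0" for \<epsilon> :: real
  proof -
    obtain \<delta> where \<delta>: "\<delta> > 0" and small: "\<And>d T. d division_of T \<Longrightarrow> T \<subseteq> {a..b} \<Longrightarrow>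
        (\<Sum>k\<in>d. Sup k - Inf k) < \<delta> \<Longrightarrow> (\<Sum>k\<in>d. \<bar>f (Sup k) - f (Inf k)\<bar>) < \<epsilon>"
      using AC e unfolding AC_on_def by blast
    obtain U where U: "open U" "N \<subseteq> U" "U \<in> lmeasurable" "measure lebesgue U < \<delta>"
    proof -
      have "N \<in> sets lebesgue" using N by (simp add: negligible_imp_sets)
      then obtain U where U: "open U" "N \<subseteq> U" "U - N \<in> lmeasurable" "emeasure lebesgue (U - N) < ennreal \<delta>"
        using sets_lebesgue_outer_open \<delta> by blast
      have "measure lebesgue (U - N) < \<delta>"
        using U(3,4) by (simp add: emeasure_eq_measure2 ennreal_less_iff)
      moreover have "U = (U - N) \<union> N" using U(2) by auto
      ultimately have "U \<in> lmeasurable" "measure lebesgue U < \<delta>"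
        using lmeasurable_Un_negligible[OF U(3) N] by auto
      with U that show ?thesis by blast
    qed
    have "\<exists>r>0. \<forall>y\<in>{a..b}. \<bar>y - x\<bar> < r \<longrightarrow> \<bar>f y - f x\<bar> \<le> \<epsilon> * \<bar>y - x\<bar>" if "x \<in> {a..b} - N" for x
      using deriv[OF that] e unfolding has_field_derivative_def has_derivative_within_alt by auto
    then obtain r where r: "\<And>x. x \<in> {a..b} - N \<Longrightarrow> r x > 0"
      "\<And>x y. x \<in> {a..b} - N \<Longrightarrow> y \<in> {a..b} \<Longrightarrow> \<bar>y - x\<bar> < r x \<Longrightarrow> \<bar>f y - f x\<bar> \<le> \<epsilon> * \<bar>y - x\<bar>"
      by metis
    define \<gamma> where "\<gamma> = (\<lambda>x. if x \<in> N then U else if x \<in> {a..b} then ball x (r x) else UNIV)"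
    have "gauge \<gamma>" using U r(1) by (auto simp: gauge_def \<gamma>_def)
    then obtain p where p: "p tagged_division_of {a..c}" "\<gamma> fine p"
      using fine_division_exists_real by blast
    note pD = tagged_division_ofD[OF p(1)]
    let ?h = "\<lambda>k. \<bar>f (Sup k) - f (Inf k)\<bar>"
    define p1 where "p1 = {(x, k) \<in> p. x \<in> N}"
    define p2 where "p2 = {(x, k) \<in> p. x \<notin> N}"
    have split: "p = p1 \<union> p2" "p1 \<inter> p2 = {}" "finite p1" "finite p2"
      using pD(1) by (auto simp: p1_def p2_def intro: finite_subset[OF _ pD(1)])
    have cell: "{Inf k..Sup k} = k \<and> Inf k \<le> Sup k \<and> x \<in> k \<and> k \<subseteq> {a..c} \<and> measure lborel k = Sup k - Inf k" 
      if xk: "(x, k) \<in> p" for x k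
    proof -
      have "x \<in> k" "k \<subseteq> {a..c}" using pD(2,3)[OF xk] by auto
      moreover obtain u v where "k = cbox u v" using pD(4)[OF xk] by blast
      moreover have "u \<le> v" using calculation by auto
      ultimately show ?thesis by auto
    qed
    have "\<bar>f c - f a\<bar> = \<bar>\<Sum>(x,k)\<in>p. f (Sup k) - f (Inf k)\<bar>"
      using additive_tagged_division_1[OF ac p(1), of f] by simp
    also have "\<dots> \<le> (\<Sum>(x,k)\<in>p. ?h k)"
      by (rule order_trans[OF sum_abs]) (auto simp: case_prod_unfold)
    also have "\<dots> = (\<Sum>(x,k)\<in>p1. ?h k) + (\<Sum>(x,k)\<in>p2. ?h k)"
      using split by (simp add: sum.union_disjoint)
    also have "(\<Sum>(x,k)\<in>p1. ?h k) \<le> \<epsilon>"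
    proof -
      let ?T = "\<Union>(snd ` p1)"
      have "p1 tagged_partial_division_of {a..c}"
        using p(1) split(1) by (metis Un_upper1 tagged_division_of_def tagged_partial_division_subset)
      then have tp: "p1 tagged_division_of ?T" by (rule tagged_partial_division_of_Union_self)
      then have dv: "snd ` p1 division_of ?T" by (rule division_of_tagged_division)
      have sub: "?T \<subseteq> {a..b}" using cell split(1) c by fastforce
      \<comment> \<open>Degenerate cells may repeat among the tagged cells, but they contribute nothing;
        the empty interval is given the value 0 explicitly, its Sup and Inf being unspecified.\<close>
      let ?g = "\<lambda>k. if k = {} then 0 else ?h k"
      have "(\<Sum>(x,k)\<in>p1. ?g k) = (\<Sum>k\<in>snd ` p1. ?g k)"
        by (rule sum.over_tagged_division_lemma[OF tp]) auto
      moreover have "(\<Sum>(x,k)\<in>p1. ?g k) = (\<Sum>(x,k)\<in>p1. ?h k)"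
        using cell split(1) by (intro sum.cong) fastforce+
      moreover have "(\<Sum>k\<in>snd ` p1. ?g k) = (\<Sum>k\<in>snd ` p1. ?h k)"
        using cell split(1) by (intro sum.cong) fastforce+
      ultimately have tagless: "(\<Sum>(x,k)\<in>p1. ?h k) = (\<Sum>k\<in>snd ` p1. ?h k)" by simp
      have TU: "?T \<subseteq> U"
        using p(2) unfolding fine_def p1_def \<gamma>_def by fastforce
      have "(\<Sum>k\<in>snd ` p1. Sup k - Inf k) = (\<Sum>k\<in>snd ` p1. measure lebesgue k)"
      proof (rule sum.cong[OF refl])
        fix k assume "k \<in> snd ` p1"
        then obtain x where "(x, k) \<in> p" using split(1) by force
        from cell[OF this] show "Sup k - Inf k = measure lebesgue k"
          by (metis borel_closed box_real(2) closed_cbox measure_completion sets_lborel)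
      qed
      also have "\<dots> = measure lebesgue ?T" by (rule content_division[OF dv])
      also have "\<dots> \<le> measure lebesgue U"
        using TU U(3) lmeasurable_division[OF dv] by (intro measure_mono_fmeasurable) auto
      also note U(4)
      finally have "(\<Sum>k\<in>snd ` p1. Sup k - Inf k) < \<delta>" .
      from small[OF dv sub this] show ?thesis unfolding tagless by (rule less_imp_le)
    qed
    also have "(\<Sum>(x,k)\<in>p2. ?h k) \<le> (\<Sum>(x,k)\<in>p2. \<epsilon> * (Sup k - Inf k))"
    proof (intro sum_mono, clarify)
      fix x k assume xk: "(x, k) \<in> p2"
      then have xp: "(x, k) \<in> p" "x \<notin> N" by (auto simp: p2_def)
      note k = cell[OF xp(1)]
      have x: "x \<in> {a..b} - N" "Inf k \<le> x" "x \<le> Sup k" using k xp c by auto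
      have "k \<subseteq> ball x (r x)" using p(2) xp x(1) unfolding fine_def \<gamma>_def by fastforce
      moreover have "Inf k \<in> k" "Sup k \<in> k" using k by (metis atLeastAtMost_iff order_refl)+
      ultimately have "\<bar>Inf k - x\<bar> < r x" "\<bar>Sup k - x\<bar> < r x" "Inf k \<in> {a..b}" "Sup k \<in> {a..b}"
        using k c by (auto simp: dist_real_def abs_minus_commute subset_eq)
      then have "\<bar>f (Inf k) - f x\<bar> \<le> \<epsilon> * \<bar>Inf k - x\<bar>" "\<bar>f (Sup k) - f x\<bar> \<le> \<epsilon> * \<bar>Sup k - x\<bar>"
        using r(2)[OF x(1)] by auto
      moreover have "\<epsilon> * \<bar>Inf k - x\<bar> = \<epsilon> * (x - Inf k)" "\<epsilon> * \<bar>Sup k - x\<bar> = \<epsilon> * (Sup k - x)" using x by auto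
      ultimately show "?h k \<le> \<epsilon> * (Sup k - Inf k)" by (auto simp: algebra_simps)
    qed
    also have "\<dots> \<le> (\<Sum>(x,k)\<in>p. \<epsilon> * (Sup k - Inf k))"
    proof (rule sum_mono2[OF pD(1)])
      show "p2 \<subseteq> p" using split by auto
      show "0 \<le> (case i of (x, k) \<Rightarrow> \<epsilon> * (Sup k - Inf k))" if "i \<in> p - p2" for i
        using that cell e by (cases i) auto
    qed
    also have "\<dots> = \<epsilon> * (c - a)"
      using additive_tagged_division_1[OF ac p(1), of "\<lambda>x. x"]
      by (simp add: case_prod_unfold flip: sum_distrib_left)
    finally show ?thesis by (simp add: algebra_simps)
  qed
  then have "\<bar>f c - f a\<bar> \<le> 0 + e" if "e > 0" for e
    using that ac by (metis add_0 add_nonneg_pos diff_ge_0_iff_ge divide_pos_pos less_irrefl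
        nonzero_eq_divide_eq zero_less_one)
  then have "\<bar>f c - f a\<bar> \<le> 0" by (rule field_le_epsilon)
  then show ?thesis by simp
qed

section \<open>Calculus of indefinite integrals on the unit interval\<close>

lemma AC_onD:
  assumes "f \<in> AC_on S" "e > 0"
  obtains \<delta> where "\<delta> > 0" "\<And>d T. d division_of T \<Longrightarrow> T \<subseteq> S \<Longrightarrow> (\<Sum>k\<in>d. Sup k - Inf k) < \<delta> \<Longrightarrow>
    (\<Sum>k\<in>d. \<bar>f (Sup k) - f (Inf k)\<bar>) < e"
  using assms unfolding AC_on_def by blast

text \<open>
  The one closure property from which products, exponentials and differences of absolutely continuous
  functions are treated: the increments of \<open>h\<close> are controlled by those of \<open>f\<close> and \<open>g\<close>.
\<close>

lemma AC_on_dominated: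
  assumes f: "f \<in> AC_on {a..b}" and g: "g \<in> AC_on {a..b}" and C: "C \<ge> 0"
    and le: "\<And>x y. x \<in> {a..b} \<Longrightarrow> y \<in> {a..b} \<Longrightarrow> \<bar>h y - h x\<bar> \<le> C * (\<bar>f y - f x\<bar> + \<bar>g y - g x\<bar>)"
  shows "h \<in> AC_on {a..b}"
  unfolding AC_on_def
proof (intro CollectI allI impI)
  fix \<epsilon> :: real assume "\<epsilon> > 0"
  define \<eta> where "\<eta> = \<epsilon> / (C + 1) / 2"
  have "\<eta> > 0" using C \<open>\<epsilon> > 0\<close> by (simp add: \<eta>_def)
  obtain \<delta>1 where 1: "\<delta>1 > 0" "\<And>d T. d division_of T \<Longrightarrow> T \<subseteq> {a..b} \<Longrightarrow> (\<Sum>k\<in>d. Sup k - Inf k) < \<delta>1 \<Longrightarrow>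
    (\<Sum>k\<in>d. \<bar>f (Sup k) - f (Inf k)\<bar>) < \<eta>" using AC_onD[OF f \<open>\<eta> > 0\<close>] by blast
  obtain \<delta>2 where 2: "\<delta>2 > 0" "\<And>d T. d division_of T \<Longrightarrow> T \<subseteq> {a..b} \<Longrightarrow> (\<Sum>k\<in>d. Sup k - Inf k) < \<delta>2 \<Longrightarrow>
    (\<Sum>k\<in>d. \<bar>g (Sup k) - g (Inf k)\<bar>) < \<eta>" using AC_onD[OF g \<open>\<eta> > 0\<close>] by blast
  show "\<exists>\<delta>>0. \<forall>d T. d division_of T \<longrightarrow> T \<subseteq> {a..b} \<longrightarrow> (\<Sum>k\<in>d. Sup k - Inf k) < \<delta> \<longrightarrow>
     (\<Sum>k\<in>d. \<bar>h (Sup k) - h (Inf k)\<bar>) < \<epsilon>"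
  proof (intro exI[of _ "min \<delta>1 \<delta>2"] conjI allI impI)
    fix d T assume d: "d division_of T" "T \<subseteq> {a..b}" and len: "(\<Sum>k\<in>d. Sup k - Inf k) < min \<delta>1 \<delta>2"
    have "(\<Sum>k\<in>d. \<bar>h (Sup k) - h (Inf k)\<bar>)
       \<le> (\<Sum>k\<in>d. C * (\<bar>f (Sup k) - f (Inf k)\<bar> + \<bar>g (Sup k) - g (Inf k)\<bar>))"
    proof (rule sum_mono)
      fix k assume "k \<in> d"
      note k = division_interval[OF d(1) this d(2)]
      show "\<bar>h (Sup k) - h (Inf k)\<bar> \<le> C * (\<bar>f (Sup k) - f (Inf k)\<bar> + \<bar>g (Sup k) - g (Inf k)\<bar>)"
        using k(2-4) by (intro le) auto
    qed
    also have "\<dots> = C * ((\<Sum>k\<in>d. \<bar>f (Sup k) - f (Inf k)\<bar>) + (\<Sum>k\<in>d. \<bar>g (Sup k) - g (Inf k)\<bar>))"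
      by (simp add: sum_distrib_left sum.distrib distrib_left)
    also have "\<dots> \<le> C * (\<eta> + \<eta>)"
      using 1(2)[OF d] 2(2)[OF d] len C by (intro mult_left_mono) auto
    also have "\<dots> = C / (C + 1) * \<epsilon>" unfolding \<eta>_def field_sum_of_halves by simp
    also have "\<dots> < 1 * \<epsilon>" using \<open>\<epsilon> > 0\<close> C by (intro mult_strict_right_mono) auto
    also have "\<dots> = \<epsilon>" by simp
    finally show "(\<Sum>k\<in>d. \<bar>h (Sup k) - h (Inf k)\<bar>) < \<epsilon>" .
  qed (use 1 2 in auto)
qed

text \<open>
  \<open>F\<close> is an indefinite integral of \<open>f \<in> L\<^sup>1(I)\<close>. The integral form is the convenient one for linear
  combinations and estimates; \<open>primitive_AC_on\<close>, \<open>primitive_deriv_ae\<close> and \<open>primitiveI_AC\<close> show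
  that it amounts to \<open>F\<close> being absolutely continuous with derivative \<open>f\<close> almost everywhere, which is
  the convenient form for products and compositions.
\<close>

definition primitive :: "(real \<Rightarrow> real) \<Rightarrow> (real \<Rightarrow> real) \<Rightarrow> bool" where
  "primitive F f \<longleftrightarrow> f absolutely_integrable_on {0..1} \<and> (\<forall>t\<in>{0..1}. F t = F 0 + integral {0..t} f)"

lemma primitive_absint: "primitive F f \<Longrightarrow> f absolutely_integrable_on {0..1}"
  unfolding primitive_def by blast

lemma primitive_eq: "primitive F f \<Longrightarrow> t \<in> {0..1} \<Longrightarrow> F t = F 0 + integral {0..t} f"
  unfolding primitive_def by blast

lemma primitive_integral:
  "f absolutely_integrable_on {0..1} \<Longrightarrow> primitive (\<lambda>t. c + integral {0..t} f) f"
  by (simp add: primitive_def)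

lemma absolutely_integrable_subinterval0:
  fixes f :: "real \<Rightarrow> real"
  assumes "f absolutely_integrable_on {0..1}" "t \<in> {0..1}"
  shows "f absolutely_integrable_on {0..t}" "f integrable_on {0..t}"
proof -
  show "f absolutely_integrable_on {0..t}"
    using assms(2) by (auto intro: absolutely_integrable_on_subinterval[OF assms(1)])
  then show "f integrable_on {0..t}" by (rule set_lebesgue_integral_eq_integral(1))
qed

lemma primitive_AC_on: 
  assumes "primitive F f"
  shows "F \<in> AC_on {0..1}"
proof -
  have "(\<lambda>t. integral {0..t} f) \<in> AC_on {0..1}" (is "?I \<in> _")
    by (rule indefinite_integral_AC_on[OF primitive_absint[OF assms]])
  then show ?thesis
  proof (rule AC_on_dominated[OF _ _ zero_le_one, of ?I _ _ ?I])
    show "?I \<in> AC_on {0..1}" by fact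
  next
    fix x y :: real assume "x \<in> {0..1}" "y \<in> {0..1}"
    then have "F y - F x = integral {0..y} f - integral {0..x} f"
      using primitive_eq[OF assms, of x] primitive_eq[OF assms, of y] by linarith
    then show "\<bar>F y - F x\<bar> \<le> 1 * (\<bar>integral {0..y} f - integral {0..x} f\<bar>
        + \<bar>integral {0..y} f - integral {0..x} f\<bar>)" by simp
  qed
qed

lemma primitive_deriv_ae:
  assumes "primitive F f"
  shows "\<exists>N. negligible N \<and> (\<forall>t\<in>{0..1} - N. (F has_real_derivative f t) (at t within {0..1}))"
proof -
  let ?N = "{t \<in> {0..1}. \<not> ((\<lambda>t. integral {0..t} f) has_real_derivative f t) (at t within {0..1})}"
  have "f integrable_on {0..1}" using primitive_absint[OF assms] by (simp add: absolutely_integrable_on_def)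
  then have "negligible ?N" by (rule indefinite_integral_has_derivative_ae)
  moreover have "(F has_real_derivative f t) (at t within {0..1})" if t: "t \<in> {0..1} - ?N" for t
  proof -
    have "((\<lambda>t. F 0 + integral {0..t} f) has_real_derivative 0 + f t) (at t within {0..1})"
      using t by (intro DERIV_add DERIV_const) auto
    then show ?thesis
      using t by (auto simp: primitive_eq[OF assms, symmetric]
          elim!: has_field_derivative_transform_within[where d=1])
  qed
  ultimately show ?thesis by blast
qed

text \<open>
  The fundamental theorem of calculus for absolutely continuous functions: \<open>F\<close> and the indefinite
  integral of \<open>f\<close> have the same derivative almost everywhere, so their difference is constant.
\<close>

lemma primitiveI_AC:
  assumes f: "f absolutely_integrable_on {0..1}" and F: "F \<in> AC_on {0..1}" and N: "negligible N"
    and deriv: "\<And>t. t \<in> {0..1} - N \<Longrightarrow> (F has_real_derivative f t) (at t within {0..1})"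
  shows "primitive F f"
proof -
  let ?H = "\<lambda>t. 0 + integral {0..t} f"
  have H: "primitive ?H f" by (rule primitive_integral[OF f])
  obtain N' where N': "negligible N'" "\<And>t. t \<in> {0..1} - N' \<Longrightarrow> (?H has_real_derivative f t) (at t within {0..1})"
    using primitive_deriv_ae[OF H] by blast
  have AC: "(\<lambda>t. F t - ?H t) \<in> AC_on {0..1}"
    by (rule AC_on_dominated[OF F primitive_AC_on[OF H] zero_le_one]) auto
  have d0: "((\<lambda>t. F t - ?H t) has_real_derivative 0) (at t within {0..1})" if "t \<in> {0..1} - (N \<union> N')" for t
    using DERIV_diff[OF deriv[of t] N'(2)[of t]] that by simp
  have "F t - ?H t = F 0 - ?H 0" if "t \<in> {0..1}" for t
    by (rule AC_on_deriv_zero_ae_const[OF AC negligible_Un[OF N N'(1)] d0 that])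
  then have "F t = F 0 + integral {0..t} f" if "t \<in> {0..1}" for t using that by force
  then show ?thesis using f unfolding primitive_def by blast
qed

lemma primitive_continuous:
  assumes "primitive F f"
  shows "continuous_on {0..1} F"
proof -
  have "f integrable_on {0..1}" using primitive_absint[OF assms] by (simp add: absolutely_integrable_on_def)
  then have "continuous_on {0..1} (\<lambda>t. F 0 + integral {0..t} f)"
    by (intro continuous_intros indefinite_integral_continuous_1)
  then show ?thesis
    by (rule continuous_on_eq) (rule primitive_eq[OF assms, symmetric])
qed

lemma primitive_bounded:
  assumes "primitive F f"
  obtains M where "\<And>t. t \<in> {0..1} \<Longrightarrow> \<bar>F t\<bar> \<le> M"
proof -
  have "bounded (F ` {0..1})"
    by (intro compact_imp_bounded compact_continuous_image primitive_continuous[OF assms] compact_Icc)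
  then obtain M where "\<forall>t\<in>{0..1}. \<bar>F t\<bar> \<le> M" unfolding bounded_iff by auto
  with that show ?thesis by blast
qed

lemma primitive_cong:
  assumes "primitive F f" "\<And>t. t \<in> {0..1} \<Longrightarrow> F t = G t" "\<And>t. t \<in> {0..1} \<Longrightarrow> f t = g t"
  shows "primitive G g"
proof -
  have "g absolutely_integrable_on {0..1}"
    using primitive_absint[OF assms(1)] assms(3) by (metis absolutely_integrable_spike_set_eq set_integrable_cong)
  moreover have "G t = G 0 + integral {0..t} g" if "t \<in> {0..1}" for t
  proof -
    have "integral {0..t} f = integral {0..t} g" using assms(3) that by (intro integral_cong) auto
    then show ?thesis using primitive_eq[OF assms(1) that] assms(2)[OF that] assms(2)[of 0] by auto
  qed
  ultimately show ?thesis unfolding primitive_def by blast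
qed

lemma primitive_lincomb:
  assumes F: "primitive F f" and G: "primitive G g"
  shows "primitive (\<lambda>t. c * F t + d * G t) (\<lambda>t. c * f t + d * g t)"
proof -
  have int: "integral {0..t} (\<lambda>t. c * f t + d * g t) = c * integral {0..t} f + d * integral {0..t} g"
    if "t \<in> {0..1}" for t
    using absolutely_integrable_subinterval0(2)[OF primitive_absint[OF F] that]
      absolutely_integrable_subinterval0(2)[OF primitive_absint[OF G] that]
    by (subst integral_add) (auto intro: integrable_on_mult_right)
  have abs: "(\<lambda>t. c * f t + d * g t) absolutely_integrable_on {0..1}"
    using primitive_absint[OF F] primitive_absint[OF G] by (intro set_integral_add set_integrable_mult_right) auto
  show ?thesis
    unfolding primitive_def
  proof (intro conjI ballI abs)
    fix t :: real assume t: "t \<in> {0..1}"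
    show "c * F t + d * G t = c * F 0 + d * G 0 + integral {0..t} (\<lambda>t. c * f t + d * g t)"
      using int[OF t] primitive_eq[OF F t] primitive_eq[OF G t] by (simp add: algebra_simps)
  qed
qed

lemma absolutely_integrable_continuous_mult:
  fixes f g :: "real \<Rightarrow> real"
  assumes "continuous_on {0..1} f" "g absolutely_integrable_on {0..1}"
  shows "(\<lambda>t. f t * g t) absolutely_integrable_on {0..1}"
proof -
  have "bounded (f ` {0..1})" using assms(1) by (intro compact_imp_bounded compact_continuous_image) auto
  moreover have "f \<in> borel_measurable (lebesgue_on {0..1})"
    using assms(1) by (intro continuous_imp_measurable_on_sets_lebesgue) auto
  ultimately show ?thesis
    using absolutely_integrable_bounded_measurable_product_real[of f "{0..1}" g] assms(2) by auto
qed

text \<open>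
  Integration by parts. Both factors are bounded, so the product is absolutely continuous, and the
  product rule holds wherever both factors are differentiable.
\<close>

lemma primitive_mult:
  assumes F: "primitive F f" and G: "primitive G g"
  shows "primitive (\<lambda>t. F t * G t) (\<lambda>t. f t * G t + F t * g t)"
proof -
  note cF = primitive_continuous[OF F] and cG = primitive_continuous[OF G]
  have int: "(\<lambda>t. f t * G t + F t * g t) absolutely_integrable_on {0..1}"
    using absolutely_integrable_continuous_mult[OF cF primitive_absint[OF G]]
      absolutely_integrable_continuous_mult[OF cG primitive_absint[OF F]]
    by (intro set_integral_add) (auto simp: mult.commute)
  obtain M1 where M1: "\<And>t. t \<in> {0..1} \<Longrightarrow> \<bar>F t\<bar> \<le> M1" using primitive_bounded[OF F] by blast
  obtain M2 where M2: "\<And>t. t \<in> {0..1} \<Longrightarrow> \<bar>G t\<bar> \<le> M2" using primitive_bounded[OF G] by blast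
  define C where "C = max M1 M2"
  have C: "\<bar>F t\<bar> \<le> C" "\<bar>G t\<bar> \<le> C" if "t \<in> {0..1}" for t
    using M1[OF that] M2[OF that] by (auto simp: C_def)
  have "C \<ge> 0" using C(1)[of 0] by auto
  have AC: "(\<lambda>t. F t * G t) \<in> AC_on {0..1}"
  proof (rule AC_on_dominated[OF primitive_AC_on[OF F] primitive_AC_on[OF G] \<open>C \<ge> 0\<close>])
    fix x y :: real assume xy: "x \<in> {0..1}" "y \<in> {0..1}"
    have "F y * G y - F x * G x = (F y - F x) * G y + F x * (G y - G x)" by (simp add: algebra_simps)
    also have "\<bar>\<dots>\<bar> \<le> \<bar>F y - F x\<bar> * \<bar>G y\<bar> + \<bar>F x\<bar> * \<bar>G y - G x\<bar>"
      by (metis abs_mult abs_triangle_ineq)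
    also have "\<dots> \<le> \<bar>F y - F x\<bar> * C + C * \<bar>G y - G x\<bar>"
      using C xy \<open>C \<ge> 0\<close> by (intro add_mono mult_mono) auto
    finally show "\<bar>F y * G y - F x * G x\<bar> \<le> C * (\<bar>F y - F x\<bar> + \<bar>G y - G x\<bar>)"
      by (simp add: algebra_simps)
  qed
  obtain N1 where N1: "negligible N1" "\<And>t. t \<in> {0..1} - N1 \<Longrightarrow> (F has_real_derivative f t) (at t within {0..1})"
    using primitive_deriv_ae[OF F] by blast
  obtain N2 where N2: "negligible N2" "\<And>t. t \<in> {0..1} - N2 \<Longrightarrow> (G has_real_derivative g t) (at t within {0..1})"
    using primitive_deriv_ae[OF G] by blast
  show ?thesis
  proof (rule primitiveI_AC[OF int AC])
    show "negligible (N1 \<union> N2)" using N1 N2 by auto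
    show "((\<lambda>t. F t * G t) has_real_derivative f t * G t + F t * g t) (at t within {0..1})"
      if "t \<in> {0..1} - (N1 \<union> N2)" for t
      using DERIV_mult[OF N1(2)[of t] N2(2)[of t]] that by (simp add: algebra_simps)
  qed
qed

lemma primitive_exp:
  assumes F: "primitive F f"
  shows "primitive (\<lambda>t. exp (F t)) (\<lambda>t. f t * exp (F t))"
proof -
  note cF = primitive_continuous[OF F]
  have int: "(\<lambda>t. f t * exp (F t)) absolutely_integrable_on {0..1}"
    using absolutely_integrable_continuous_mult[OF continuous_on_exp[OF cF] primitive_absint[OF F]]
    by (simp add: mult.commute)
  obtain M where M: "\<And>t. t \<in> {0..1} \<Longrightarrow> \<bar>F t\<bar> \<le> M" using primitive_bounded[OF F] by blast
  have lip: "exp q - exp p \<le> exp M * (q - p)" if "p \<le> q" "q \<le> M" for p q :: real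
  proof -
    have "1 - exp (p - q) \<le> q - p" using exp_ge_add_one_self[of "p - q"] by linarith
    then have "exp q * (1 - exp (p - q)) \<le> exp M * (q - p)"
      using that by (intro mult_mono) auto
    then show ?thesis by (simp add: algebra_simps flip: exp_add)
  qed
  have AC: "(\<lambda>t. exp (F t)) \<in> AC_on {0..1}"
  proof (rule AC_on_dominated[OF primitive_AC_on[OF F] primitive_AC_on[OF F]])
    fix x y :: real assume xy: "x \<in> {0..1}" "y \<in> {0..1}"
    then have "F x \<le> M" "F y \<le> M" using M by fastforce+
    then have "\<bar>exp (F y) - exp (F x)\<bar> \<le> exp M * \<bar>F y - F x\<bar>"
      using lip[of "F x" "F y"] lip[of "F y" "F x"] by (cases "F x \<le> F y") auto
    also have "\<dots> \<le> exp M * (\<bar>F y - F x\<bar> + \<bar>F y - F x\<bar>)" by (intro mult_left_mono) auto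
    finally show "\<bar>exp (F y) - exp (F x)\<bar> \<le> exp M * (\<bar>F y - F x\<bar> + \<bar>F y - F x\<bar>)" .
  qed simp
  obtain N where N: "negligible N" "\<And>t. t \<in> {0..1} - N \<Longrightarrow> (F has_real_derivative f t) (at t within {0..1})"
    using primitive_deriv_ae[OF F] by blast
  show ?thesis
  proof (rule primitiveI_AC[OF int AC N(1)])
    show "((\<lambda>t. exp (F t)) has_real_derivative f t * exp (F t)) (at t within {0..1})" if "t \<in> {0..1} - N" for t
      using N(2)[OF that] by (auto intro!: derivative_eq_intros)
  qed
qed

text \<open>
  When the density is continuous, the derivative exists at every point of \<open>I\<close>, as \<open>W21\<close> demands of \<open>u\<close>.
\<close>

lemma primitive_continuous_derivative:
  assumes F: "primitive F f" and f: "continuous_on {0..1} f" and t: "t \<in> {0..1}"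
  shows "(F has_real_derivative f t) (at t within {0..1})"
proof -
  have "((\<lambda>t. F 0 + integral {0..t} f) has_real_derivative 0 + f t) (at t within {0..1})"
    using integral_has_real_derivative[OF f t] by (intro DERIV_add DERIV_const)
  then show ?thesis
    using t by (auto simp: primitive_eq[OF F, symmetric]
        elim!: has_field_derivative_transform_within[where d=1])
qed

lemma primitiveI_continuous_derivative:
  assumes f: "continuous_on {0..1} f"
    and F: "\<And>t. t \<in> {0..1} \<Longrightarrow> (F has_real_derivative f t) (at t within {0..1})"
  shows "primitive F f"
proof -
  have "integral {0..t} f = F t - F 0" if "t \<in> {0..1}" for t
  proof (rule integral_unique, rule fundamental_theorem_of_calculus)
    fix x assume "x \<in> {0..t}"
    then show "(F has_vector_derivative f x) (at x within {0..t})"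
      using F[of x] that unfolding has_real_derivative_iff_has_vector_derivative
      by (auto elim: has_vector_derivative_within_subset)
  qed (use that in auto)
  then have "F t = F 0 + integral {0..t} f" if "t \<in> {0..1}" for t using that by simp
  then show ?thesis
    using absolutely_integrable_continuous_real[OF f] unfolding primitive_def by blast
qed

section \<open>The differential equation in integral form\<close>

text \<open>
  The equation \<open>u'' + b u = \<sigma>\<close> as a first order system in integral form, with \<open>v\<close> in the role of \<open>u'\<close>.
  By \<open>solution_imp_solves\<close> and \<open>solves_imp_solution\<close> this is membership in \<open>W21\<close> together with
  \<open>solves\<close>, but it no longer mentions derivatives or exceptional sets.
\<close>

definition solution :: "(real \<Rightarrow> real) \<Rightarrow> (real \<Rightarrow> real) \<Rightarrow> (real \<Rightarrow> real) \<Rightarrow> (real \<Rightarrow> real) \<Rightarrow> bool" where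
  "solution b \<sigma> u v \<longleftrightarrow> primitive u v \<and> primitive v (\<lambda>t. \<sigma> t - b t * u t)"

lemma AE_unit_interval_iff:
  "(AE t in lebesgue_on {0..1::real}. P t) \<longleftrightarrow> (\<exists>N. negligible N \<and> (\<forall>t\<in>{0..1} - N. P t))"
proof -
  have "(AE t in lebesgue_on {0..1::real}. P t) \<longleftrightarrow> (AE t in lebesgue. t \<in> {0..1} \<longrightarrow> P t)"
    by (simp add: AE_restrict_space_iff)
  also have "\<dots> \<longleftrightarrow> (\<exists>N. negligible N \<and> (\<forall>t\<in>{0..1} - N. P t))"
    unfolding eventually_ae_filter negligible_iff_null_sets Bex_def
    by (intro arg_cong[where f=Ex] ext conj_cong refl) auto
  finally show ?thesis .
qed

lemma integrable_unit_interval_iff: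
  fixes f :: "real \<Rightarrow> real"
  shows "integrable (lebesgue_on {0..1}) f \<longleftrightarrow> f absolutely_integrable_on {0..1}"
  by (simp add: integrable_restrict_space set_integrable_def)

lemma solution_derivative:
  assumes "solution b \<sigma> u v" "t \<in> {0..1}"
  shows "(u has_real_derivative v t) (at t within {0..1})" "D u t = v t"
proof -
  show "(u has_real_derivative v t) (at t within {0..1})"
    using assms primitive_continuous by (auto simp: solution_def intro!: primitive_continuous_derivative)
  then show "D u t = v t"
    unfolding D_def has_real_derivative_iff_has_vector_derivative
    by (intro vector_derivative_within_closed_interval) (use assms in auto)
qed

lemma solution_imp_solves:
  assumes "solution (\<lambda>t. a t + lam) \<sigma> u v"
  shows "u \<in> W21" "solves a lam \<sigma> u"
proof -
  have u: "primitive u v" and v: "primitive v (\<lambda>t. \<sigma> t - (a t + lam) * u t)"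
    using assms by (auto simp: solution_def)
  have Du: "D u t = v t" if "t \<in> {0..1}" for t using solution_derivative[OF assms that] by simp
  have "D u \<in> AC_on {0..1}"
    by (rule AC_on_dominated[OF primitive_AC_on[OF v] primitive_AC_on[OF v] zero_le_one]) (simp add: Du)
  moreover have "u differentiable_on {0..1}"
    unfolding differentiable_on_def
    using solution_derivative(1)[OF assms] real_differentiable_def by blast
  ultimately show "u \<in> W21" using primitive_continuous[OF u] by (simp add: W21_def)
  obtain N where N: "negligible N" 
    "\<And>t. t \<in> {0..1} - N \<Longrightarrow> (v has_real_derivative \<sigma> t - (a t + lam) * u t) (at t within {0..1})"
    using primitive_deriv_ae[OF v] by blast
  have "(D u has_real_derivative \<sigma> t - (a t + lam) * u t) (at t within {0..1})" if "t \<in> {0..1} - N" for t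
    using N(2)[OF that] that by (auto simp: Du elim!: has_field_derivative_transform_within[where d=1])
  then have "\<forall>t\<in>{0..1} - N. \<exists>d. (D u has_real_derivative d) (at t within {0..1}) \<and> d + (a t + lam) * u t = \<sigma> t"
    by (metis diff_add_cancel)
  with N(1) show "solves a lam \<sigma> u"
    unfolding solves_def AE_unit_interval_iff by blast
qed

lemma absolutely_integrable_coeff:
  fixes a :: "real \<Rightarrow> real"
  assumes "integrable (lebesgue_on {0..1}) a"
  shows "(\<lambda>t. a t + lam) absolutely_integrable_on {0..1}"
proof (rule set_integral_add)
  show "a absolutely_integrable_on {0..1}" using assms by (simp add: integrable_unit_interval_iff)
  show "(\<lambda>t. lam) absolutely_integrable_on {0..1::real}" by (intro absolutely_integrable_continuous_real continuous_intros)
qed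

lemma solves_imp_solution:
  assumes a: "integrable (lebesgue_on {0..1}) a" and \<sigma>: "integrable (lebesgue_on {0..1}) \<sigma>"
    and u: "u \<in> W21" "solves a lam \<sigma> u"
  shows "solution (\<lambda>t. a t + lam) \<sigma> u (D u)"
proof -
  have cu: "continuous_on {0..1} u" and AC: "D u \<in> AC_on {0..1}" and diff: "u differentiable_on {0..1}"
    using u(1) by (auto simp: W21_def)
  obtain N where N: "negligible N" "\<And>t. t \<in> {0..1} - N \<Longrightarrow>
      \<exists>d. (D u has_real_derivative d) (at t within {0..1}) \<and> d + (a t + lam) * u t = \<sigma> t"
    using u(2) unfolding solves_def AE_unit_interval_iff by blast
  have int: "(\<lambda>t. \<sigma> t - (a t + lam) * u t) absolutely_integrable_on {0..1}"
    using absolutely_integrable_continuous_mult[OF cu absolutely_integrable_coeff[OF a, of lam]] \<sigma>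
    unfolding integrable_unit_interval_iff by (intro set_integral_diff) (auto simp: mult.commute)
  have v: "primitive (D u) (\<lambda>t. \<sigma> t - (a t + lam) * u t)"
  proof (rule primitiveI_AC[OF int AC N(1)])
    fix t assume "t \<in> {0..1} - N"
    then obtain d where d: "(D u has_real_derivative d) (at t within {0..1})" "d + (a t + lam) * u t = \<sigma> t"
      using N(2) by blast
    then have "d = \<sigma> t - (a t + lam) * u t" by simp
    then show "(D u has_real_derivative \<sigma> t - (a t + lam) * u t) (at t within {0..1})" using d(1) by simp
  qed
  moreover have "primitive u (D u)"
  proof (rule primitiveI_continuous_derivative[OF primitive_continuous[OF v]])
    fix t :: real assume "t \<in> {0..1}"
    then have "u differentiable (at t within {0..1})" using diff by (simp add: differentiable_on_def)
    then show "(u has_real_derivative D u t) (at t within {0..1})"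
      unfolding D_def has_real_derivative_iff_has_vector_derivative vector_derivative_works[symmetric] .
  qed
  ultimately show ?thesis by (simp add: solution_def)
qed

lemma solution_lincomb:
  assumes 1: "solution b \<sigma> u v" and 2: "solution b \<tau> y z"
  shows "solution b (\<lambda>t. c * \<sigma> t + d * \<tau> t) (\<lambda>t. c * u t + d * y t) (\<lambda>t. c * v t + d * z t)"
  unfolding solution_def
proof
  show "primitive (\<lambda>t. c * u t + d * y t) (\<lambda>t. c * v t + d * z t)"
    using assms by (auto simp: solution_def intro: primitive_lincomb)
  have "primitive (\<lambda>t. c * v t + d * z t) (\<lambda>t. c * (\<sigma> t - b t * u t) + d * (\<tau> t - b t * y t))"
    using assms by (auto simp: solution_def intro: primitive_lincomb)
  then show "primitive (\<lambda>t. c * v t + d * z t) (\<lambda>t. c * \<sigma> t + d * \<tau> t - b t * (c * u t + d * y t))"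
    by (rule primitive_cong) (simp_all add: algebra_simps)
qed

lemma solution_cong:
  assumes "solution b \<sigma> u v" "\<And>t. t \<in> {0..1} \<Longrightarrow> \<sigma> t = \<tau> t" 
    "\<And>t. t \<in> {0..1} \<Longrightarrow> u t = y t" "\<And>t. t \<in> {0..1} \<Longrightarrow> v t = z t"
  shows "solution b \<tau> y z"
  using assms by (auto simp: solution_def intro: primitive_cong)

text \<open>
  A Bielecki weight: \<open>weight b\<close> satisfies \<open>w' = 2 \<bar>b\<bar> w\<close> almost everywhere, so integrating \<open>\<bar>b\<bar>\<close> against it gains the
  factor \<open>1/2\<close>. With respect to the supremum norm of \<open>u / weight b\<close> the Volterra operator is therefore
  a contraction on the whole of \<open>I\<close>, however large \<open>b\<close> is.
\<close>

definition weight :: "(real \<Rightarrow> real) \<Rightarrow> real \<Rightarrow> real" where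
  "weight b t = exp (2 * integral {0..t} (\<lambda>s. \<bar>b s\<bar>))"

lemma weight_pos: "weight b t > 0" and weight_0: "weight b 0 = 1"
  by (simp_all add: weight_def)

lemma primitive_weight:
  assumes b: "b absolutely_integrable_on {0..1}"
  shows "primitive (weight b) (\<lambda>t. 2 * \<bar>b t\<bar> * weight b t)"
proof -
  have "(\<lambda>t. 2 * \<bar>b t\<bar>) absolutely_integrable_on {0..1}"
    using absolutely_integrable_norm[OF b] by (intro set_integrable_mult_right) (simp add: o_def)
  from primitive_exp[OF primitive_integral[OF this, of 0]] show ?thesis
    by (simp add: weight_def[abs_def])
qed

lemma weight_mono:
  assumes b: "b absolutely_integrable_on {0..1}" and "0 \<le> \<tau>" "\<tau> \<le> t" "t \<le> 1"
  shows "weight b \<tau> \<le> weight b t"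
proof -
  have b': "(\<lambda>t. \<bar>b t\<bar>) absolutely_integrable_on {0..1}"
    using absolutely_integrable_norm[OF b] by (simp add: o_def)
  have "integral {0..\<tau>} (\<lambda>s. \<bar>b s\<bar>) \<le> integral {0..t} (\<lambda>s. \<bar>b s\<bar>)"
    using assms absolutely_integrable_subinterval0(2)[OF b', of \<tau>] absolutely_integrable_subinterval0(2)[OF b', of t]
    by (intro integral_subset_le) auto
  then show ?thesis by (simp add: weight_def)
qed

definition volterra :: "(real \<Rightarrow> real) \<Rightarrow> (real \<Rightarrow> real) \<Rightarrow> real \<Rightarrow> real" where
  "volterra b u t = integral {0..t} (\<lambda>\<tau>. integral {0..\<tau>} (\<lambda>s. b s * u s))"

lemma volterra_inner:
  fixes b u :: "real \<Rightarrow> real"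
  assumes b: "b absolutely_integrable_on {0..1}" and u: "continuous_on {0..1} u"
  shows "(\<lambda>s. b s * u s) absolutely_integrable_on {0..1}"
    "continuous_on {0..1} (\<lambda>\<tau>. integral {0..\<tau>} (\<lambda>s. b s * u s))"
proof -
  show *: "(\<lambda>s. b s * u s) absolutely_integrable_on {0..1}"
    using absolutely_integrable_continuous_mult[OF u b] by (simp add: mult.commute)
  show "continuous_on {0..1} (\<lambda>\<tau>. integral {0..\<tau>} (\<lambda>s. b s * u s))"
    using primitive_continuous[OF primitive_integral[OF *, of 0]] by simp
qed

lemma volterra_continuous:
  assumes b: "b absolutely_integrable_on {0..1}" and u: "continuous_on {0..1} u"
  shows "continuous_on {0..1} (volterra b u)"
  using primitive_continuous[OF primitive_integral[OF
      absolutely_integrable_continuous_real[OF volterra_inner(2)[OF b u]], of 0]]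
  by (simp add: volterra_def[abs_def])

lemma volterra_diff:
  assumes b: "b absolutely_integrable_on {0..1}" and u: "continuous_on {0..1} u" and y: "continuous_on {0..1} y"
    and t: "t \<in> {0..1}"
  shows "volterra b (\<lambda>s. u s - y s) t = volterra b u t - volterra b y t"
proof -
  note iu = volterra_inner[OF b u] and iy = volterra_inner[OF b y]
  have "integral {0..\<tau>} (\<lambda>s. b s * (u s - y s)) = integral {0..\<tau>} (\<lambda>s. b s * u s) - integral {0..\<tau>} (\<lambda>s. b s * y s)"
    if "\<tau> \<in> {0..1}" for \<tau>
    using absolutely_integrable_subinterval0(2)[OF iu(1) that] absolutely_integrable_subinterval0(2)[OF iy(1) that]
    by (simp add: right_diff_distrib Henstock_Kurzweil_Integration.integral_diff)
  then have "volterra b (\<lambda>s. u s - y s) t 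
     = integral {0..t} (\<lambda>\<tau>. integral {0..\<tau>} (\<lambda>s. b s * u s) - integral {0..\<tau>} (\<lambda>s. b s * y s))"
    unfolding volterra_def using t by (intro integral_cong) auto
  also have "\<dots> = volterra b u t - volterra b y t"
    unfolding volterra_def
    using iu(2) iy(2) t by (intro Henstock_Kurzweil_Integration.integral_diff integrable_continuous_real)
       (auto elim: continuous_on_subset)
  finally show ?thesis .
qed

text \<open>
  The inner integral is at most \<open>M\<close> times the integral of \<open>\<bar>b\<bar> * weight b\<close>, which is half the
  increment of the weight. The outer integral is taken over an interval of length at most 1, on which
  the increasing weight is bounded by its last value.
\<close>

lemma volterra_contraction:
  assumes b: "b absolutely_integrable_on {0..1}" and h: "continuous_on {0..1} h"
    and bound: "\<And>s. s \<in> {0..1} \<Longrightarrow> \<bar>h s\<bar> \<le> M * weight b s" and t: "t \<in> {0..1}"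
  shows "\<bar>volterra b h t\<bar> \<le> M / 2 * weight b t"
proof -
  have "0 \<le> M" using bound[of 0] weight_0[of b] by auto
  note inner = volterra_inner[OF b h]
  have iw: "(\<lambda>s. 2 * \<bar>b s\<bar> * weight b s) absolutely_integrable_on {0..1}"
    by (rule primitive_absint[OF primitive_weight[OF b]])
  have inner_bound: "\<bar>integral {0..\<tau>} (\<lambda>s. b s * h s)\<bar> \<le> M / 2 * weight b t" if \<tau>: "\<tau> \<in> {0..t}" for \<tau>
  proof -
    have \<tau>1: "\<tau> \<in> {0..1}" using \<tau> t by auto
    have "\<bar>integral {0..\<tau>} (\<lambda>s. b s * h s)\<bar> \<le> integral {0..\<tau>} (\<lambda>s. M / 2 * (2 * \<bar>b s\<bar> * weight b s))"
    proof (rule integral_norm_bound_integral[of "\<lambda>s. b s * h s", unfolded real_norm_def])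
      show "(\<lambda>s. b s * h s) integrable_on {0..\<tau>}" using absolutely_integrable_subinterval0(2)[OF inner(1) \<tau>1] .
      show "(\<lambda>s. M / 2 * (2 * \<bar>b s\<bar> * weight b s)) integrable_on {0..\<tau>}"
        using absolutely_integrable_subinterval0(2)[OF iw \<tau>1] by (rule integrable_on_mult_right)
      fix s assume "s \<in> {0..\<tau>}"
      then have "\<bar>b s\<bar> * \<bar>h s\<bar> \<le> \<bar>b s\<bar> * (M * weight b s)"
        using \<tau>1 by (intro mult_left_mono bound) auto
      then show "\<bar>b s * h s\<bar> \<le> M / 2 * (2 * \<bar>b s\<bar> * weight b s)"
        by (simp add: abs_mult algebra_simps)
    qed
    also have "\<dots> = M / 2 * integral {0..\<tau>} (\<lambda>s. 2 * \<bar>b s\<bar> * weight b s)"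
      by (rule integral_mult_right)
    also have "\<dots> = M / 2 * (weight b \<tau> - 1)"
      using primitive_eq[OF primitive_weight[OF b] \<tau>1] weight_0[of b] by simp
    also have "\<dots> \<le> M / 2 * weight b t"
      using weight_mono[OF b, of \<tau> t] \<tau> t \<open>0 \<le> M\<close> by (intro mult_left_mono) auto
    finally show ?thesis .
  qed
  have "\<bar>volterra b h t\<bar> \<le> M / 2 * weight b t * (t - 0)"
    unfolding volterra_def real_norm_def[symmetric]
    by (rule integral_bound) (use t inner_bound in \<open>auto intro: continuous_on_subset[OF inner(2)]\<close>)
  also have "\<dots> \<le> M / 2 * weight b t * 1"
    using t \<open>0 \<le> M\<close> weight_pos[of b t] by (intro mult_left_mono) auto
  finally show ?thesis by simp
qed

text \<open>
  Banach's fixed point theorem for \<open>w = u / weight b\<close> in the space of bounded continuous functions on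
  the real line; functions on \<open>I\<close> enter this space by composing them with the projection onto \<open>I\<close>.
\<close>

lemma volterra_fixed_point:
  assumes b: "b absolutely_integrable_on {0..1}" and g: "continuous_on {0..1} g"
  obtains u where "continuous_on {0..1} u" "\<And>t. t \<in> {0..1} \<Longrightarrow> u t = g t - volterra b u t"
proof -
  define \<pi> :: "real \<Rightarrow> real" where "\<pi> = (\<lambda>t. max 0 (min 1 t))"
  have \<pi>: "\<pi> t \<in> {0..1}" "t \<in> {0..1} \<Longrightarrow> \<pi> t = t" for t by (auto simp: \<pi>_def)
  have c\<pi>: "continuous_on UNIV \<pi>" unfolding \<pi>_def by (intro continuous_intros)
  have cw: "continuous_on {0..1} (weight b)" by (rule primitive_continuous[OF primitive_weight[OF b]])
  define \<Phi> where "\<Phi> = (\<lambda>w t. (g t - volterra b (\<lambda>s. weight b s * w s) t) / weight b t)"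
  have cww: "continuous_on {0..1} (\<lambda>s. weight b s * apply_bcontfun w s)" for w :: "real \<Rightarrow>\<^sub>C real"
    by (intro continuous_on_mult cw) simp
  have c\<Phi>: "continuous_on {0..1} (\<Phi> (apply_bcontfun w))" for w
    unfolding \<Phi>_def using weight_pos[of b]
    by (intro continuous_intros g cw volterra_continuous b cww) (metis less_irrefl)
  have bc: "(\<lambda>t. \<Phi> (apply_bcontfun w) (\<pi> t)) \<in> bcontfun" for w
  proof -
    have "continuous_on UNIV (\<lambda>t. \<Phi> (apply_bcontfun w) (\<pi> t))"
      by (rule continuous_on_compose2[OF c\<Phi> c\<pi>]) (use \<pi> in auto)
    moreover have "bounded (\<Phi> (apply_bcontfun w) ` {0..1})"
      by (intro compact_imp_bounded compact_continuous_image c\<Phi> compact_Icc)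
    then have "bounded (range (\<lambda>t. \<Phi> (apply_bcontfun w) (\<pi> t)))"
      by (rule bounded_subset) (use \<pi> in auto)
    ultimately show ?thesis by (simp add: bcontfun_def)
  qed
  define T where "T = (\<lambda>w. Bcontfun (\<lambda>t. \<Phi> (apply_bcontfun w) (\<pi> t)))"
  have T: "apply_bcontfun (T w) t = \<Phi> (apply_bcontfun w) (\<pi> t)" for w t
    unfolding T_def by (subst Bcontfun_inverse[OF bc]) simp
  have "dist (T w) (T z) \<le> 1 / 2 * dist w z" for w z
  proof (rule dist_bound)
    fix t
    let ?d = "\<lambda>s. weight b s * apply_bcontfun w s - weight b s * apply_bcontfun z s"
    have "\<bar>volterra b ?d (\<pi> t)\<bar> \<le> dist w z / 2 * weight b (\<pi> t)"
    proof (rule volterra_contraction[OF b _ _ \<pi>(1)])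
      show "continuous_on {0..1} ?d" by (intro continuous_on_diff cww)
      fix s :: real
      have "\<bar>?d s\<bar> = \<bar>apply_bcontfun w s - apply_bcontfun z s\<bar> * weight b s"
        using weight_pos[of b s] by (simp add: abs_mult flip: right_diff_distrib)
      also have "\<dots> \<le> dist w z * weight b s"
        using weight_pos[of b s] dist_bounded[of w s z]
        by (intro mult_right_mono) (auto simp: dist_real_def)
      finally show "\<bar>?d s\<bar> \<le> dist w z * weight b s" .
    qed
    then have "\<bar>volterra b ?d (\<pi> t)\<bar> / weight b (\<pi> t) \<le> 1 / 2 * dist w z"
      using weight_pos[of b "\<pi> t"] by (simp add: field_simps)
    moreover have "dist (apply_bcontfun (T w) t) (apply_bcontfun (T z) t) = \<bar>volterra b ?d (\<pi> t)\<bar> / weight b (\<pi> t)"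
      using weight_pos[of b "\<pi> t"]
      by (simp add: T \<Phi>_def dist_real_def volterra_diff[OF b cww cww \<pi>(1)] abs_minus_commute 
          flip: diff_divide_distrib)
    ultimately show "dist (apply_bcontfun (T w) t) (apply_bcontfun (T z) t) \<le> 1 / 2 * dist w z" by simp
  qed
  then obtain w where w: "T w = w" using banach_fix_type[of "1/2" T] by auto
  show ?thesis
  proof
    show "continuous_on {0..1} (\<lambda>s. weight b s * apply_bcontfun w s)" by (rule cww)
    fix t :: real assume t: "t \<in> {0..1}"
    have "apply_bcontfun w t = \<Phi> (apply_bcontfun w) t" using T[of w t] \<pi>(2)[OF t] by (simp add: w)
    then show "weight b t * apply_bcontfun w t = g t - volterra b (\<lambda>s. weight b s * apply_bcontfun w s) t"
      using weight_pos[of b t] by (simp add: \<Phi>_def field_simps)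
  qed
qed

lemma solution_exists:
  assumes b: "b absolutely_integrable_on {0..1}"
  obtains u v where "solution b (\<lambda>_. 0) u v" "u 0 = c0" "v 0 = c1"
proof -
  have "continuous_on {0..1} (\<lambda>t. c0 + c1 * t)" by (intro continuous_intros)
  from volterra_fixed_point[OF b this] obtain u where cu: "continuous_on {0..1} u" 
    and u: "\<And>t. t \<in> {0..1} \<Longrightarrow> u t = c0 + c1 * t - volterra b u t" by blast
  note inner = volterra_inner[OF b cu]
  define v where "v = (\<lambda>t. c1 + integral {0..t} (\<lambda>s. 0 - b s * u s))"
  have "(\<lambda>s. 0 - b s * u s) absolutely_integrable_on {0..1}"
    using set_integrable_mult_right[OF inner(1), of "-1"] by simp
  then have v: "primitive v (\<lambda>s. 0 - b s * u s)" unfolding v_def by (rule primitive_integral)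
  have "u t = u 0 + integral {0..t} v" if t: "t \<in> {0..1}" for t
  proof -
    have "integral {0..t} v = integral {0..t} (\<lambda>\<tau>. c1 - integral {0..\<tau>} (\<lambda>s. b s * u s))"
      by (simp add: v_def[abs_def])
    also have "\<dots> = integral {0..t} (\<lambda>\<tau>. c1) - volterra b u t"
      unfolding volterra_def using t
      by (intro Henstock_Kurzweil_Integration.integral_diff integrable_continuous_real 
          continuous_on_subset[OF inner(2)]) auto
    also have "\<dots> = c1 * t - volterra b u t" using t by simp
    finally show ?thesis using u[OF t] u[of 0] by (simp add: volterra_def)
  qed
  then have "primitive u v"
    using absolutely_integrable_continuous_real[OF primitive_continuous[OF v]] unfolding primitive_def by blast
  moreover have "u 0 = c0" "v 0 = c1" using u[of 0] by (simp_all add: v_def volterra_def)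
  ultimately show ?thesis using v that[of u v] by (simp add: solution_def)
qed

text \<open>
  A solution with zero initial values is a fixed point of the contraction \<open>- volterra b\<close>: at a point
  where \<open>\<bar>u\<bar> / weight b\<close> is maximal, \<open>volterra_contraction\<close> bounds this maximum by half of itself.
\<close>

lemma solution_zero:
  assumes b: "b absolutely_integrable_on {0..1}"
    and sol: "solution b (\<lambda>_. 0) u v" and u0: "u 0 = 0" and v0: "v 0 = 0" and t: "t \<in> {0..1}"
  shows "u t = 0" "v t = 0"
proof -
  have pu: "primitive u v" and pv: "primitive v (\<lambda>s. 0 - b s * u s)" using sol by (auto simp: solution_def)
  note cu = primitive_continuous[OF pu]
  have v: "v \<tau> = - integral {0..\<tau>} (\<lambda>s. b s * u s)" if "\<tau> \<in> {0..1}" for \<tau>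
    using primitive_eq[OF pv that] v0 by simp
  have u: "u \<tau> = - volterra b u \<tau>" if \<tau>: "\<tau> \<in> {0..1}" for \<tau>
  proof -
    have "integral {0..\<tau>} v = integral {0..\<tau>} (\<lambda>r. - integral {0..r} (\<lambda>s. b s * u s))"
      using \<tau> by (intro integral_cong v) auto
    then show ?thesis using primitive_eq[OF pu \<tau>] u0 by (simp add: volterra_def)
  qed
  have "continuous_on {0..1} (\<lambda>t. \<bar>u t\<bar> / weight b t)"
    using primitive_continuous[OF primitive_weight[OF b]] weight_pos[of b]
    by (intro continuous_intros cu) (metis less_irrefl)+
  from continuous_attains_sup[OF compact_Icc _ this]
  obtain m where m: "m \<in> {0..1}" "\<And>t. t \<in> {0..1} \<Longrightarrow> \<bar>u t\<bar> / weight b t \<le> \<bar>u m\<bar> / weight b m" by auto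
  have le: "\<bar>u s\<bar> \<le> \<bar>u m\<bar> / weight b m * weight b s" if "s \<in> {0..1}" for s
    using m(2)[OF that] weight_pos[of b s] by (simp add: pos_divide_le_eq)
  have "\<bar>u m\<bar> \<le> \<bar>u m\<bar> / weight b m / 2 * weight b m"
    using volterra_contraction[OF b cu le m(1)] u[OF m(1)] by simp
  then have "u m = 0" using weight_pos[of b m] by simp
  then have z: "u s = 0" if "s \<in> {0..1}" for s using le[OF that] by simp
  show "u t = 0" by (rule z[OF t])
  have "integral {0..t} (\<lambda>s. b s * u s) = integral {0..t} (\<lambda>s. 0)" using z t by (intro integral_cong) auto
  then show "v t = 0" using v[OF t] by simp
qed

lemma solution_unique:
  assumes b: "b absolutely_integrable_on {0..1}"
    and 1: "solution b \<sigma> u v" and 2: "solution b \<sigma> y z" and "u 0 = y 0" "v 0 = z 0" and t: "t \<in> {0..1}"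
  shows "u t = y t" "v t = z t"
proof -
  have "solution b (\<lambda>_. 0) (\<lambda>t. 1 * u t + (-1) * y t) (\<lambda>t. 1 * v t + (-1) * z t)"
    by (rule solution_cong[OF solution_lincomb[OF 1 2, of 1 "-1"]]) auto
  from solution_zero[OF b this _ _ t] assms show "u t = y t" "v t = z t" by auto
qed

section \<open>Uniqueness of Green's functions and boundary derivatives\<close>

lemma D_eqI:
  assumes "(f has_real_derivative d) (at t within {0..1})" "t \<in> {0..1}"
  shows "D f t = d"
  using assms unfolding D_def has_real_derivative_iff_has_vector_derivative
  by (intro vector_derivative_within_closed_interval) auto

text \<open>
  At an endpoint the value of \<open>extend\<close> is a limit along the open interval, where \<open>g\<close> may be
  replaced by \<open>k\<close>. This turns explicit formulas for the derivatives of Green's functions, computed on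
  the open interval, into formulas on all of \<open>I\<close>.
\<close>

lemma extend_eq_continuous:
  assumes k: "continuous_on {0..1} k" and g: "\<And>x. x \<in> {0<..<1} \<Longrightarrow> g x = k x" and x: "x \<in> {0..1}"
  shows "extend g x = k x"
proof (cases "x \<in> {0<..<1}")
  case True
  then show ?thesis using g by (simp add: extend_def)
next
  case False
  with x have "x = 0 \<or> x = 1" by auto
  then have "x islimpt {0<..<1}"
    using islimpt_greaterThanLessThan1[of 0 "1::real"] islimpt_greaterThanLessThan2[of 0 "1::real"] by auto
  then have nb: "at x within {0<..<1} \<noteq> bot" by (simp add: trivial_limit_within)
  have "(k \<longlongrightarrow> k x) (at x within {0<..<1})"
    using k x by (meson continuous_on_def greaterThanLessThan_subseteq_atLeastAtMost_iff order_refl tendsto_within_subset)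
  then have "(g \<longlongrightarrow> k x) (at x within {0<..<1})"
    by (rule Lim_transform_eventually) (auto simp: eventually_at_filter g)
  with nb have "Lim (at x within {0<..<1}) g = k x" by (rule tendsto_Lim)
  then show ?thesis unfolding extend_def by (simp only: False if_False)
qed

lemma integral_square_eq_0_imp:
  fixes h :: "real \<Rightarrow> real"
  assumes h: "continuous_on {0..1} h" and 0: "integral {0..1} (\<lambda>s. h s * h s) = 0" and s: "s \<in> {0..1}"
  shows "h s = 0"
proof -
  have "continuous_on {0..1} (\<lambda>s. h s * h s)" by (intro continuous_intros h)
  then have "\<forall>s\<in>{0..1}. h s * h s = 0"
    using integral_eq_0_iff[of 0 1 "\<lambda>s. h s * h s"] 0 by auto
  then show ?thesis using s by simp
qed

lemma lebesgue_eq_integral_kernel: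
  fixes g \<sigma> :: "real \<Rightarrow> real"
  assumes "continuous_on {0..1} g" "integrable (lebesgue_on {0..1}) \<sigma>"
  shows "integral\<^sup>L (lebesgue_on {0..1}) (\<lambda>s. g s * \<sigma> s) = integral {0..1} (\<lambda>s. g s * \<sigma> s)"
  using absolutely_integrable_continuous_mult[of g \<sigma>] assms
  by (intro lebesgue_integral_eq_integral) (auto simp: integrable_unit_interval_iff)

lemma continuous_kernel_section:
  assumes "continuous_on ({0..1} \<times> {0..1}) (\<lambda>(t, s). G t s)" "t \<in> {0..1}"
  shows "continuous_on {0..1} (\<lambda>s. G t s)"
proof -
  have "continuous_on {0..1} (\<lambda>s. case (t, s) of (t, s) \<Rightarrow> G t s)"
    by (rule continuous_on_compose2[OF assms(1)]) (use assms(2) in \<open>auto intro: continuous_intros\<close>)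
  then show ?thesis by simp
qed

text \<open>
  For fixed \<open>t\<close> both kernels give the same integral against every \<open>\<sigma>\<close>, in particular against their
  own difference \<open>\<sigma> = G t - H t\<close>, so the integral of its square is 0.
\<close>

lemma is_green_unique:
  assumes G: "is_green a lam X G" and H: "is_green a lam X H" and t: "t \<in> {0..1}" and s: "s \<in> {0..1}"
  shows "G t s = H t s"
proof -
  have cG: "continuous_on {0..1} (\<lambda>s. G t s)" and cH: "continuous_on {0..1} (\<lambda>s. H t s)"
    using G H t by (auto simp: is_green_def intro!: continuous_kernel_section)
  define \<sigma> where "\<sigma> = (\<lambda>s. G t s - H t s)"
  have c\<sigma>: "continuous_on {0..1} \<sigma>" unfolding \<sigma>_def by (intro continuous_intros cG cH)
  then have i\<sigma>: "integrable (lebesgue_on {0..1}) \<sigma>" 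
    by (simp add: integrable_unit_interval_iff absolutely_integrable_continuous_real)
  define u where "u = (\<lambda>t. integral\<^sup>L (lebesgue_on {0..1}) (\<lambda>s. G t s * \<sigma> s))"
  have "u \<in> X \<and> solves a lam \<sigma> u" using G i\<sigma> unfolding is_green_def u_def by blast
  then have "u t = integral\<^sup>L (lebesgue_on {0..1}) (\<lambda>s. H t s * \<sigma> s)"
    using H i\<sigma> t unfolding is_green_def by blast
  then have eq: "integral {0..1} (\<lambda>s. G t s * \<sigma> s) = integral {0..1} (\<lambda>s. H t s * \<sigma> s)"
    by (simp add: u_def lebesgue_eq_integral_kernel[OF cG i\<sigma>] lebesgue_eq_integral_kernel[OF cH i\<sigma>])
  have "integral {0..1} (\<lambda>s. G t s * \<sigma> s - H t s * \<sigma> s) = 0"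
    using eq cG cH c\<sigma> by (subst Henstock_Kurzweil_Integration.integral_diff)
      (auto intro!: integrable_continuous_real continuous_intros)
  then have "integral {0..1} (\<lambda>s. \<sigma> s * \<sigma> s) = 0" by (simp add: \<sigma>_def left_diff_distrib)
  from integral_square_eq_0_imp[OF c\<sigma> this s] show ?thesis by (simp add: \<sigma>_def)
qed

lemma green_eqI:
  assumes "is_green a lam X G" "t \<in> {0..1}" "s \<in> {0..1}"
  shows "green X a lam t s = G t s"
proof -
  have "\<exists>G. is_green a lam X G" using assms(1) by blast
  then have "is_green a lam X (green X a lam)" unfolding green_def by (rule someI_ex)
  then show ?thesis using assms by (intro is_green_unique)
qed

lemma mem_X_P_iff:
  assumes "solution (\<lambda>t. a t + lam) \<sigma> u v"
  shows "u \<in> X_P \<longleftrightarrow> u 0 = u 1 \<and> v 0 = v 1"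
  using solution_imp_solves(1)[OF assms] solution_derivative(2)[OF assms] by (simp add: X_P_def)

lemma mem_X_M2_iff:
  assumes "solution (\<lambda>t. a t + lam) \<sigma> u v"
  shows "u \<in> X_M2 \<longleftrightarrow> u 0 = 0 \<and> v 1 = 0"
  using solution_imp_solves(1)[OF assms] solution_derivative(2)[OF assms] by (simp add: X_M2_def)

lemma nonresonantD:
  assumes nr: "nonresonant a lam X" and sol: "solution (\<lambda>t. a t + lam) (\<lambda>_. 0) u v" and u: "u \<in> X" 
    and t: "t \<in> {0..1}"
  shows "u t = 0" "v t = 0"
proof -
  have z: "u t = 0" if "t \<in> {0..1}" for t
    using nr u solution_imp_solves(2)[OF sol] that unfolding nonresonant_def by blast
  then show "u t = 0" using t .
  have "(u has_real_derivative 0) (at t within {0..1})"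
    by (rule has_field_derivative_transform_within[where f="\<lambda>_. 0" and d=1]) (use t z in auto)
  from D_eqI[OF this t] show "v t = 0" using solution_derivative(2)[OF sol t] by simp
qed

section \<open>Fundamental solutions and variation of parameters\<close>

locale fundamental_system =
  fixes a :: "real \<Rightarrow> real" and lam :: real and \<phi> \<phi>' \<psi> \<psi>' :: "real \<Rightarrow> real"
  assumes a: "integrable (lebesgue_on {0..1}) a"
    and sol_\<phi>: "solution (\<lambda>t. a t + lam) (\<lambda>_. 0) \<phi> \<phi>'" and \<phi>0: "\<phi> 0 = 1" "\<phi>' 0 = 0"
    and sol_\<psi>: "solution (\<lambda>t. a t + lam) (\<lambda>_. 0) \<psi> \<psi>'" and \<psi>0: "\<psi> 0 = 0" "\<psi>' 0 = 1"
begin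

abbreviation b :: "real \<Rightarrow> real" where "b t \<equiv> a t + lam"

text \<open>
  The Cauchy function of the equation: \<open>K t s\<close> as a function of \<open>t\<close> is the homogeneous solution with
  value 0 and derivative 1 at \<open>s\<close>, and \<open>K' t s\<close> is its derivative in \<open>t\<close>.
\<close>

definition K :: "real \<Rightarrow> real \<Rightarrow> real" where "K t s = \<psi> t * \<phi> s - \<phi> t * \<psi> s"
definition K' :: "real \<Rightarrow> real \<Rightarrow> real" where "K' t s = \<psi>' t * \<phi> s - \<phi>' t * \<psi> s"

lemma b_absint: "b absolutely_integrable_on {0..1}"
  by (rule absolutely_integrable_coeff[OF a])

lemma primitives:
  "primitive \<phi> \<phi>'" "primitive \<phi>' (\<lambda>t. 0 - b t * \<phi> t)" "primitive \<psi> \<psi>'" "primitive \<psi>' (\<lambda>t. 0 - b t * \<psi> t)"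
  using sol_\<phi> sol_\<psi> by (auto simp: solution_def)

lemma fundamental_continuous:
  "continuous_on {0..1} \<phi>" "continuous_on {0..1} \<phi>'" "continuous_on {0..1} \<psi>" "continuous_on {0..1} \<psi>'"
  using primitives by (auto intro: primitive_continuous)

lemma wronskian:
  assumes "t \<in> {0..1}"
  shows "\<phi> t * \<psi>' t - \<phi>' t * \<psi> t = 1"
proof -
  let ?f = "\<lambda>t. 1 * (\<phi>' t * \<psi>' t + \<phi> t * (0 - b t * \<psi> t)) + (-1) * ((0 - b t * \<phi> t) * \<psi> t + \<phi>' t * \<psi>' t)"
  have "primitive (\<lambda>t. 1 * (\<phi> t * \<psi>' t) + (-1) * (\<phi>' t * \<psi> t)) ?f"
    by (intro primitive_lincomb primitive_mult primitives)
  moreover have "?f = (\<lambda>t. 0)" by (auto simp: algebra_simps)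
  ultimately have "primitive (\<lambda>t. 1 * (\<phi> t * \<psi>' t) + (-1) * (\<phi>' t * \<psi> t)) (\<lambda>t. 0)" by simp
  from primitive_eq[OF this assms] show ?thesis by (simp add: \<phi>0 \<psi>0)
qed

lemma K_initial: "K t 0 = \<psi> t" "K' t 0 = \<psi>' t" "K t t = 0"
  by (simp_all add: K_def K'_def \<phi>0 \<psi>0)

lemma homogeneous_eq:
  assumes "solution b (\<lambda>_. 0) u v" "t \<in> {0..1}"
  shows "u t = u 0 * \<phi> t + v 0 * \<psi> t" "v t = u 0 * \<phi>' t + v 0 * \<psi>' t"
proof -
  have *: "solution b (\<lambda>_. 0) (\<lambda>t. u 0 * \<phi> t + v 0 * \<psi> t) (\<lambda>t. u 0 * \<phi>' t + v 0 * \<psi>' t)"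
    using solution_lincomb[OF sol_\<phi> sol_\<psi>, of "u 0" "v 0"] by simp
  show "u t = u 0 * \<phi> t + v 0 * \<psi> t" "v t = u 0 * \<phi>' t + v 0 * \<psi>' t"
    using solution_unique[OF b_absint assms(1) * _ _ assms(2)] by (simp_all add: \<phi>0 \<psi>0)
qed

text \<open>
  With \<open>A\<close> and \<open>B\<close> the indefinite integrals of \<open>\<phi> * \<sigma>\<close> and \<open>\<psi> * \<sigma>\<close>, the particular solution is
  \<open>\<psi> * A - \<phi> * B\<close>. In its first derivative the terms with \<open>\<sigma>\<close> cancel; in the second they have the
  Wronskian as their coefficient, which is 1.
\<close>

lemma variation_of_parameters:
  assumes \<sigma>: "\<sigma> absolutely_integrable_on {0..1}"
  shows "solution b \<sigma> (\<lambda>t. integral {0..t} (\<lambda>s. K t s * \<sigma> s)) (\<lambda>t. integral {0..t} (\<lambda>s. K' t s * \<sigma> s))"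
proof -
  define A where "A = (\<lambda>t. 0 + integral {0..t} (\<lambda>s. \<phi> s * \<sigma> s))"
  define B where "B = (\<lambda>t. 0 + integral {0..t} (\<lambda>s. \<psi> s * \<sigma> s))"
  have i\<phi>: "(\<lambda>s. \<phi> s * \<sigma> s) absolutely_integrable_on {0..1}" and i\<psi>: "(\<lambda>s. \<psi> s * \<sigma> s) absolutely_integrable_on {0..1}"
    by (intro absolutely_integrable_continuous_mult fundamental_continuous \<sigma>)+
  have A: "primitive A (\<lambda>s. \<phi> s * \<sigma> s)" and B: "primitive B (\<lambda>s. \<psi> s * \<sigma> s)"
    unfolding A_def B_def by (intro primitive_integral i\<phi> i\<psi>)+
  define p where "p = (\<lambda>t. 1 * (\<psi> t * A t) + (-1) * (\<phi> t * B t))"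
  define q where "q = (\<lambda>t. 1 * (\<psi>' t * A t) + (-1) * (\<phi>' t * B t))"
  have "primitive p (\<lambda>t. 1 * (\<psi>' t * A t + \<psi> t * (\<phi> t * \<sigma> t)) + (-1) * (\<phi>' t * B t + \<phi> t * (\<psi> t * \<sigma> t)))"
    unfolding p_def by (intro primitive_lincomb primitive_mult primitives A B)
  then have p: "primitive p q"
    by (rule primitive_cong) (simp_all add: q_def algebra_simps)
  have "primitive q (\<lambda>t. 1 * ((0 - b t * \<psi> t) * A t + \<psi>' t * (\<phi> t * \<sigma> t)) + (-1) * ((0 - b t * \<phi> t) * B t + \<phi>' t * (\<psi> t * \<sigma> t)))"
    unfolding q_def by (intro primitive_lincomb primitive_mult primitives A B)
  then have q: "primitive q (\<lambda>t. \<sigma> t - b t * p t)"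
  proof (rule primitive_cong)
    fix t :: real assume t: "t \<in> {0..1}"
    have "1 * ((0 - b t * \<psi> t) * A t + \<psi>' t * (\<phi> t * \<sigma> t)) + (-1) * ((0 - b t * \<phi> t) * B t + \<phi>' t * (\<psi> t * \<sigma> t))
        = (\<phi> t * \<psi>' t - \<phi>' t * \<psi> t) * \<sigma> t - b t * p t"
      by (simp add: p_def algebra_simps)
    then show "1 * ((0 - b t * \<psi> t) * A t + \<psi>' t * (\<phi> t * \<sigma> t)) + (-1) * ((0 - b t * \<phi> t) * B t + \<phi>' t * (\<psi> t * \<sigma> t))
        = \<sigma> t - b t * p t" using wronskian[OF t] by simp
  qed simp
  have split: "integral {0..t} (\<lambda>s. (c * \<phi> s - d * \<psi> s) * \<sigma> s) = c * A t - d * B t" if t: "t \<in> {0..1}" for c d t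
  proof -
    have "integral {0..t} (\<lambda>s. (c * \<phi> s - d * \<psi> s) * \<sigma> s) = integral {0..t} (\<lambda>s. c * (\<phi> s * \<sigma> s) - d * (\<psi> s * \<sigma> s))"
      by (simp add: algebra_simps)
    also have "\<dots> = c * A t - d * B t"
      using absolutely_integrable_subinterval0(2)[OF i\<phi> t] absolutely_integrable_subinterval0(2)[OF i\<psi> t]
      by (subst Henstock_Kurzweil_Integration.integral_diff) (auto simp: A_def B_def intro: integrable_on_mult_right)
    finally show ?thesis .
  qed
  have "solution b \<sigma> p q" using p q by (simp add: solution_def)
  then show ?thesis
    by (rule solution_cong) (simp_all add: p_def q_def K_def K'_def split)
qed

subsection \<open>Kernels satisfying boundary conditions\<close>

text \<open>
  The general form of a Green's function: a homogeneous solution in \<open>t\<close>, to be adjusted to the boundary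
  conditions, is added to the kernel of the initial value problem. \<open>green_kernel'\<close> is its
  derivative in \<open>t\<close>, taken from the right where \<open>s = t\<close>.
\<close>

definition green_kernel :: "(real \<Rightarrow> real) \<Rightarrow> (real \<Rightarrow> real) \<Rightarrow> real \<Rightarrow> real \<Rightarrow> real" where
  "green_kernel \<alpha> \<beta> t s = (if s \<le> t then K t s else 0) + (\<alpha> s * \<phi> t + \<beta> s * \<psi> t)"

definition green_kernel' :: "(real \<Rightarrow> real) \<Rightarrow> (real \<Rightarrow> real) \<Rightarrow> real \<Rightarrow> real \<Rightarrow> real" where
  "green_kernel' \<alpha> \<beta> t s = (if s \<le> t then K' t s else 0) + (\<alpha> s * \<phi>' t + \<beta> s * \<psi>' t)"

text \<open>
  Because \<open>K\<close> vanishes on the diagonal, its cut-off at \<open>s = t\<close> equals \<open>K (max s t) s\<close>, which is visibly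
  continuous.
\<close>

lemma green_kernel_continuous:
  assumes "continuous_on {0..1} \<alpha>" "continuous_on {0..1} \<beta>"
  shows "continuous_on ({0..1} \<times> {0..1}) (\<lambda>(t, s). green_kernel \<alpha> \<beta> t s)"
proof -
  have *: "continuous_on ({0..1} \<times> {0..1}) (\<lambda>x::real \<times> real. f (fst x))"
       "continuous_on ({0..1} \<times> {0..1}) (\<lambda>x::real \<times> real. f (snd x))"
       "continuous_on ({0..1} \<times> {0..1}) (\<lambda>x::real \<times> real. f (max (snd x) (fst x)))"
    if "continuous_on {0..1} f" for f :: "real \<Rightarrow> real"
    by (rule continuous_on_compose2[OF that]; auto intro!: continuous_intros)+
  have "green_kernel \<alpha> \<beta> t s = K (max s t) s + (\<alpha> s * \<phi> t + \<beta> s * \<psi> t)" for t s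
    by (simp add: green_kernel_def K_initial max_def)
  then show ?thesis
    unfolding K_def case_prod_unfold
    by (simp only:) (intro continuous_intros * fundamental_continuous assms)
qed

lemma kernel_solution:
  assumes \<sigma>: "\<sigma> absolutely_integrable_on {0..1}" and \<alpha>: "continuous_on {0..1} \<alpha>" and \<beta>: "continuous_on {0..1} \<beta>"
  shows "solution b \<sigma> (\<lambda>t. integral {0..1} (\<lambda>s. green_kernel \<alpha> \<beta> t s * \<sigma> s)) (\<lambda>t. integral {0..1} (\<lambda>s. green_kernel' \<alpha> \<beta> t s * \<sigma> s))"
proof -
  define A where "A = integral {0..1} (\<lambda>s. \<alpha> s * \<sigma> s)"
  define B where "B = integral {0..1} (\<lambda>s. \<beta> s * \<sigma> s)"
  have i: "(\<lambda>s. \<alpha> s * \<sigma> s) integrable_on {0..1}" "(\<lambda>s. \<beta> s * \<sigma> s) integrable_on {0..1}"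
    using absolutely_integrable_continuous_mult[OF \<alpha> \<sigma>] absolutely_integrable_continuous_mult[OF \<beta> \<sigma>]
    by (auto simp: absolutely_integrable_on_def)
  have split: "integral {0..1} (\<lambda>s. ((if s \<le> t then c * \<phi> s - d * \<psi> s else 0) + (\<alpha> s * x + \<beta> s * y)) * \<sigma> s)
     = integral {0..t} (\<lambda>s. (c * \<phi> s - d * \<psi> s) * \<sigma> s) + (A * x + B * y)" if t: "t \<in> {0..1}" for t c d x y
  proof -
    let ?k = "\<lambda>s. (c * \<phi> s - d * \<psi> s) * \<sigma> s"
    have "continuous_on {0..1} (\<lambda>s. c * \<phi> s - d * \<psi> s)" by (intro continuous_intros fundamental_continuous)
    from absolutely_integrable_subinterval0(2)[OF absolutely_integrable_continuous_mult[OF this \<sigma>] t]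
    have k: "(?k has_integral integral {0..t} ?k) {0..t}" by (rule integrable_integral)
    have "((\<lambda>s. if s \<in> {0..t} then ?k s else 0) has_integral integral {0..t} ?k) {0..1}"
    proof (rule has_integral_on_superset)
      show "((\<lambda>s. if s \<in> {0..t} then ?k s else 0) has_integral integral {0..t} ?k) {0..t}"
        using k by (subst has_integral_restrict) simp_all
    qed (use t in auto)
    then have "((\<lambda>s. (if s \<in> {0..t} then ?k s else 0) + (\<alpha> s * \<sigma> s * x + \<beta> s * \<sigma> s * y)) has_integral 
       integral {0..t} ?k + (A * x + B * y)) {0..1}"
      unfolding A_def B_def by (intro has_integral_add has_integral_mult_left integrable_integral i)
    then have "((\<lambda>s. ((if s \<le> t then c * \<phi> s - d * \<psi> s else 0) + (\<alpha> s * x + \<beta> s * y)) * \<sigma> s) has_integral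
       integral {0..t} ?k + (A * x + B * y)) {0..1}"
      by (rule has_integral_eq[rotated]) (simp add: algebra_simps)
    then show ?thesis by (rule integral_unique)
  qed
  have "solution b (\<lambda>t. A * 0 + B * 0) (\<lambda>t. A * \<phi> t + B * \<psi> t) (\<lambda>t. A * \<phi>' t + B * \<psi>' t)"
    by (rule solution_lincomb[OF sol_\<phi> sol_\<psi>])
  from solution_lincomb[OF variation_of_parameters[OF \<sigma>, unfolded K_def K'_def] this, of 1 1]
  show ?thesis
    unfolding green_kernel_def green_kernel'_def K_def K'_def
    by (rule solution_cong) (simp_all add: split)
qed

text \<open>
  A kernel of this form always produces a solution, so it is the Green's function as soon as that
  solution lies in \<open>X\<close>; nonresonance makes it the only one. Two properties of \<open>X\<close> enter: it is
  closed under differences, and membership depends on the values on \<open>I\<close> alone.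
\<close>

lemma is_green_kernelI:
  assumes \<alpha>: "continuous_on {0..1} \<alpha>" and \<beta>: "continuous_on {0..1} \<beta>"
    and nr: "nonresonant a lam X" and XW: "X \<subseteq> W21"
    and diff: "\<And>u v y z \<sigma>. solution b \<sigma> u v \<Longrightarrow> solution b \<sigma> y z \<Longrightarrow> u \<in> X \<Longrightarrow> y \<in> X \<Longrightarrow> (\<lambda>t. u t - y t) \<in> X"
    and cong: "\<And>u v y z \<sigma>. solution b \<sigma> u v \<Longrightarrow> solution b \<sigma> y z \<Longrightarrow> u \<in> X \<Longrightarrow> (\<And>t. t \<in> {0..1} \<Longrightarrow> y t = u t \<and> z t = v t) \<Longrightarrow> y \<in> X"
    and bc: "\<And>\<sigma>. \<sigma> absolutely_integrable_on {0..1} \<Longrightarrow> (\<lambda>t. integral {0..1} (\<lambda>s. green_kernel \<alpha> \<beta> t s * \<sigma> s)) \<in> X"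
  shows "is_green a lam X (green_kernel \<alpha> \<beta>)"
  unfolding is_green_def
proof (intro conjI allI impI)
  show c: "continuous_on ({0..1} \<times> {0..1}) (\<lambda>(t, s). green_kernel \<alpha> \<beta> t s)" by (rule green_kernel_continuous[OF \<alpha> \<beta>])
  fix \<sigma> :: "real \<Rightarrow> real" and u :: "real \<Rightarrow> real" assume i\<sigma>: "integrable (lebesgue_on {0..1}) \<sigma>"
  then have \<sigma>: "\<sigma> absolutely_integrable_on {0..1}" by (simp add: integrable_unit_interval_iff)
  define w where "w = (\<lambda>t. integral {0..1} (\<lambda>s. green_kernel \<alpha> \<beta> t s * \<sigma> s))"
  obtain w' where w: "solution b \<sigma> w w'" using kernel_solution[OF \<sigma> \<alpha> \<beta>] unfolding w_def by blast
  have wX: "w \<in> X" unfolding w_def by (rule bc[OF \<sigma>])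
  have L: "integral\<^sup>L (lebesgue_on {0..1}) (\<lambda>s. green_kernel \<alpha> \<beta> t s * \<sigma> s) = w t" if "t \<in> {0..1}" for t
    unfolding w_def by (rule lebesgue_eq_integral_kernel[OF continuous_kernel_section[OF c that] i\<sigma>])
  have "u \<in> X \<and> solves a lam \<sigma> u \<longleftrightarrow> (\<forall>t\<in>{0..1}. u t = w t)"
  proof
    assume u: "u \<in> X \<and> solves a lam \<sigma> u"
    then have su: "solution b \<sigma> u (D u)" using XW solves_imp_solution[OF a i\<sigma>] by blast
    have "solution b (\<lambda>_. 0) (\<lambda>t. u t - w t) (\<lambda>t. D u t - w' t)"
      by (rule solution_cong[OF solution_lincomb[OF su w, of 1 "-1"]]) simp_all
    from nonresonantD(1)[OF nr this diff[OF su w]] u wX show "\<forall>t\<in>{0..1}. u t = w t" by simp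
  next
    assume eq: "\<forall>t\<in>{0..1}. u t = w t"
    then have u: "solution b \<sigma> u w'" by (auto intro: solution_cong[OF w])
    then show "u \<in> X \<and> solves a lam \<sigma> u"
      using cong[OF w u wX] eq solution_imp_solves(2)[OF u] by auto
  qed
  then show "u \<in> X \<and> solves a lam \<sigma> u \<longleftrightarrow> 
      (\<forall>t\<in>{0..1}. u t = integral\<^sup>L (lebesgue_on {0..1}) (\<lambda>s. green_kernel \<alpha> \<beta> t s * \<sigma> s))"
    using L by simp
qed

text \<open>
  Boundary conditions are verified for \<open>s\<close> in the open interval only: the jump of \<open>green_kernel'\<close> on the
  diagonal spoils the periodic ones at the corner \<open>(0, 0)\<close>.
\<close>

lemma integral_eq_interior:
  fixes f g :: "real \<Rightarrow> real"
  assumes "\<And>s. s \<in> {0<..<1} \<Longrightarrow> f s = g s"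
  shows "integral {0..1} (\<lambda>s. f s * \<sigma> s) = integral {0..1} (\<lambda>s. g s * \<sigma> s :: real)"
  by (rule integral_spike[of "{0, 1}"]) (use assms in \<open>auto simp: less_le\<close>)

lemma is_green_X_P:
  assumes \<alpha>: "continuous_on {0..1} \<alpha>" and \<beta>: "continuous_on {0..1} \<beta>" and nr: "nonresonant a lam X_P"
    and bc: "\<And>s. s \<in> {0<..<1} \<Longrightarrow> green_kernel \<alpha> \<beta> 0 s = green_kernel \<alpha> \<beta> 1 s"
            "\<And>s. s \<in> {0<..<1} \<Longrightarrow> green_kernel' \<alpha> \<beta> 0 s = green_kernel' \<alpha> \<beta> 1 s"
  shows "is_green a lam X_P (green_kernel \<alpha> \<beta>)"
proof (rule is_green_kernelI[OF \<alpha> \<beta> nr])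
  show "X_P \<subseteq> W21" by (auto simp: X_P_def)
  fix u v y z \<sigma> assume u: "solution b \<sigma> u v" and y: "solution b \<sigma> y z" and uX: "u \<in> X_P"
  show "(\<lambda>t. u t - y t) \<in> X_P" if "y \<in> X_P"
    using uX that mem_X_P_iff[OF u] mem_X_P_iff[OF y] mem_X_P_iff[OF solution_lincomb[OF u y, of 1 "-1"]] by simp
  show "y \<in> X_P" if "\<And>t. t \<in> {0..1} \<Longrightarrow> y t = u t \<and> z t = v t"
    using uX that mem_X_P_iff[OF u] mem_X_P_iff[OF y] by simp
next
  fix \<sigma> :: "real \<Rightarrow> real" assume "\<sigma> absolutely_integrable_on {0..1}"
  from mem_X_P_iff[OF kernel_solution[OF this \<alpha> \<beta>]]
  show "(\<lambda>t. integral {0..1} (\<lambda>s. green_kernel \<alpha> \<beta> t s * \<sigma> s)) \<in> X_P"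
    using integral_eq_interior[of "green_kernel \<alpha> \<beta> 0" "green_kernel \<alpha> \<beta> 1" \<sigma>, OF bc(1)]
      integral_eq_interior[of "green_kernel' \<alpha> \<beta> 0" "green_kernel' \<alpha> \<beta> 1" \<sigma>, OF bc(2)] by simp
qed

lemma is_green_X_M2:
  assumes \<alpha>: "continuous_on {0..1} \<alpha>" and \<beta>: "continuous_on {0..1} \<beta>" and nr: "nonresonant a lam X_M2"
    and bc: "\<And>s. s \<in> {0<..<1} \<Longrightarrow> green_kernel \<alpha> \<beta> 0 s = 0" "\<And>s. s \<in> {0<..<1} \<Longrightarrow> green_kernel' \<alpha> \<beta> 1 s = 0"
  shows "is_green a lam X_M2 (green_kernel \<alpha> \<beta>)"
proof (rule is_green_kernelI[OF \<alpha> \<beta> nr])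
  show "X_M2 \<subseteq> W21" by (auto simp: X_M2_def)
  fix u v y z \<sigma> assume u: "solution b \<sigma> u v" and y: "solution b \<sigma> y z" and uX: "u \<in> X_M2"
  show "(\<lambda>t. u t - y t) \<in> X_M2" if "y \<in> X_M2"
    using uX that mem_X_M2_iff[OF u] mem_X_M2_iff[OF y] mem_X_M2_iff[OF solution_lincomb[OF u y, of 1 "-1"]] by simp
  show "y \<in> X_M2" if "\<And>t. t \<in> {0..1} \<Longrightarrow> y t = u t \<and> z t = v t"
    using uX that mem_X_M2_iff[OF u] mem_X_M2_iff[OF y] by simp
next
  fix \<sigma> :: "real \<Rightarrow> real" assume "\<sigma> absolutely_integrable_on {0..1}"
  from mem_X_M2_iff[OF kernel_solution[OF this \<alpha> \<beta>]]
  show "(\<lambda>t. integral {0..1} (\<lambda>s. green_kernel \<alpha> \<beta> t s * \<sigma> s)) \<in> X_M2"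
    using integral_eq_interior[of "green_kernel \<alpha> \<beta> 0" "\<lambda>_. 0" \<sigma>] integral_eq_interior[of "green_kernel' \<alpha> \<beta> 1" "\<lambda>_. 0" \<sigma>] bc 
    by simp
qed

subsection \<open>The periodic and the mixed problem\<close>

lemma solution_combination:
  "solution b (\<lambda>_. 0) (\<lambda>t. p * \<phi> t + q * \<psi> t) (\<lambda>t. p * \<phi>' t + q * \<psi>' t)"
  using solution_lincomb[OF sol_\<phi> sol_\<psi>, of p q] by simp

text \<open>
  The determinant belongs to the linear system for \<open>(p, q)\<close> which says that \<open>p * \<phi> + q * \<psi>\<close> is
  periodic. If it vanished, both columns of the adjugate matrix would solve the system and hence be
  zero by nonresonance; then all coefficients vanish, and \<open>(1, 0)\<close> would be a nontrivial solution.
\<close>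

lemma periodic_determinant_nonzero:
  assumes nr: "nonresonant a lam X_P"
  shows "(1 - \<phi> 1) * (1 - \<psi>' 1) - \<psi> 1 * \<phi>' 1 \<noteq> 0"
proof
  assume \<Delta>: "(1 - \<phi> 1) * (1 - \<psi>' 1) - \<psi> 1 * \<phi>' 1 = 0"
  have triv: "p = 0 \<and> q = 0" if "p * (1 - \<phi> 1) - q * \<psi> 1 = 0" "q * (1 - \<psi>' 1) - p * \<phi>' 1 = 0" for p q
  proof -
    have "(\<lambda>t. p * \<phi> t + q * \<psi> t) \<in> X_P"
      using that unfolding mem_X_P_iff[OF solution_combination] by (simp add: \<phi>0 \<psi>0 algebra_simps)
    from nonresonantD[OF nr solution_combination this, of 0] show ?thesis by (simp add: \<phi>0 \<psi>0)
  qed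
  have "\<psi> 1 = 0 \<and> 1 - \<phi> 1 = 0" using \<Delta> by (intro triv) (simp_all add: algebra_simps)
  moreover have "1 - \<psi>' 1 = 0 \<and> \<phi>' 1 = 0" using \<Delta> by (intro triv) (simp_all add: algebra_simps)
  ultimately show False using triv[of 1 0] by simp
qed

text \<open>
  The coefficients \<open>p\<close> and \<open>q\<close> come from Cramer's rule.
\<close>

lemma periodic_jump_solution_exists:
  assumes nr: "nonresonant a lam X_P"
  shows "\<exists>u. u \<in> W21 \<and> solves a lam (\<lambda>_. 0) u \<and> u 0 - u 1 = c \<and> D u 0 - D u 1 = d"
proof -
  define \<Delta> where "\<Delta> = (1 - \<phi> 1) * (1 - \<psi>' 1) - \<psi> 1 * \<phi>' 1"
  have "\<Delta> \<noteq> 0" using periodic_determinant_nonzero[OF nr] by (simp add: \<Delta>_def)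
  define p where "p = (c * (1 - \<psi>' 1) + d * \<psi> 1) / \<Delta>"
  define q where "q = (d * (1 - \<phi> 1) + c * \<phi>' 1) / \<Delta>"
  note sol = solution_combination[of p q]
  have "p * (1 - \<phi> 1) - q * \<psi> 1 = c * \<Delta> / \<Delta>" "q * (1 - \<psi>' 1) - p * \<phi>' 1 = d * \<Delta> / \<Delta>"
    unfolding p_def q_def by (simp_all add: \<Delta>_def algebra_simps flip: diff_divide_distrib add_divide_distrib)
  then have "p * (1 - \<phi> 1) - q * \<psi> 1 = c" "q * (1 - \<psi>' 1) - p * \<phi>' 1 = d" using \<open>\<Delta> \<noteq> 0\<close> by simp_all
  then show ?thesis
    using solution_imp_solves[OF sol] solution_derivative(2)[OF sol]
    by (intro exI[of _ "\<lambda>t. p * \<phi> t + q * \<psi> t"]) (simp add: \<phi>0 \<psi>0 algebra_simps)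
qed

lemma r3_solution:
  assumes nr: "nonresonant a lam X_P"
  shows "solution b (\<lambda>_. 0) (r3 a lam) (D (r3 a lam))" "r3 a lam 0 - r3 a lam 1 = 1" "D (r3 a lam) 0 - D (r3 a lam) 1 = 0"
  using someI_ex[OF periodic_jump_solution_exists[OF nr, of 1 0]] unfolding r3_def[symmetric]
  by (auto intro: solves_imp_solution[OF a])

lemma r4_solution:
  assumes nr: "nonresonant a lam X_P"
  shows "solution b (\<lambda>_. 0) (r4 a lam) (D (r4 a lam))" "r4 a lam 0 - r4 a lam 1 = 0" "D (r4 a lam) 0 - D (r4 a lam) 1 = 1"
  using someI_ex[OF periodic_jump_solution_exists[OF nr, of 0 1]] unfolding r4_def[symmetric]
  by (auto intro: solves_imp_solution[OF a])

text \<open>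
  A homogeneous solution is determined by its jumps between the two ends of \<open>I\<close>: the difference of the
  two sides is a homogeneous solution without jumps, that is, in \<open>X_P\<close>, and nonresonance makes it 0.
\<close>

lemma homogeneous_eq_jumps:
  assumes nr: "nonresonant a lam X_P" and u: "solution b (\<lambda>_. 0) u v" and t: "t \<in> {0..1}"
  shows "u t = (u 0 - u 1) * r3 a lam t + (v 0 - v 1) * r4 a lam t"
proof -
  note r3 = r3_solution[OF nr] and r4 = r4_solution[OF nr]
  let ?c = "u 0 - u 1" and ?d = "v 0 - v 1"
  have "solution b (\<lambda>_. 0) (\<lambda>t. 1 * u t + (-1) * (?c * r3 a lam t + ?d * r4 a lam t))
      (\<lambda>t. 1 * v t + (-1) * (?c * D (r3 a lam) t + ?d * D (r4 a lam) t))" (is "solution _ _ ?w ?w'")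
    by (rule solution_cong[OF solution_lincomb[OF u solution_lincomb[OF r3(1) r4(1), of ?c ?d], of 1 "-1"]]) simp_all
  note w = this
  have "?w 0 - ?w 1 = ?c - (?c * (r3 a lam 0 - r3 a lam 1) + ?d * (r4 a lam 0 - r4 a lam 1))"
    by (simp add: algebra_simps)
  moreover have "?w' 0 - ?w' 1 = ?d - (?c * (D (r3 a lam) 0 - D (r3 a lam) 1) + ?d * (D (r4 a lam) 0 - D (r4 a lam) 1))"
    by (simp add: algebra_simps)
  ultimately have "?w \<in> X_P" unfolding mem_X_P_iff[OF w] r3(2,3) r4(2,3) by simp
  from nonresonantD(1)[OF nr w this t] show ?thesis by simp
qed

lemma K_continuous: "continuous_on {0..1} (K t)" "continuous_on {0..1} (K' t)"
  unfolding K_def K'_def by (intro continuous_intros fundamental_continuous)+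

text \<open>
  Between the ends of \<open>I\<close> the truncated Cauchy function has the jumps \<open>- K 1 s\<close> in value and \<open>- K' 1 s\<close>
  in derivative; adding \<open>r3 * K 1 s\<close> and \<open>r4 * K' 1 s\<close> cancels them.
\<close>

lemma G_P_eq:
  assumes nr: "nonresonant a lam X_P" and t: "t \<in> {0..1}" and s: "s \<in> {0..1}"
  shows "G_P a lam t s = (if s \<le> t then K t s else 0) + r3 a lam t * K 1 s + r4 a lam t * K' 1 s"
proof -
  note r3 = r3_solution[OF nr] and r4 = r4_solution[OF nr]
  note h3 = homogeneous_eq[OF r3(1)] and h4 = homogeneous_eq[OF r4(1)]
  define \<alpha> where "\<alpha> = (\<lambda>s. r3 a lam 0 * K 1 s + r4 a lam 0 * K' 1 s)"
  define \<beta> where "\<beta> = (\<lambda>s. D (r3 a lam) 0 * K 1 s + D (r4 a lam) 0 * K' 1 s)"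
  have c: "continuous_on {0..1} \<alpha>" "continuous_on {0..1} \<beta>"
    unfolding \<alpha>_def \<beta>_def by (intro continuous_intros K_continuous)+
  have k: "green_kernel \<alpha> \<beta> t s = (if s \<le> t then K t s else 0) + r3 a lam t * K 1 s + r4 a lam t * K' 1 s"
    if "t \<in> {0..1}" for t s
    by (simp add: green_kernel_def \<alpha>_def \<beta>_def h3(1)[OF that] h4(1)[OF that] algebra_simps)
  have k': "green_kernel' \<alpha> \<beta> t s = (if s \<le> t then K' t s else 0) + D (r3 a lam) t * K 1 s + D (r4 a lam) t * K' 1 s"
    if "t \<in> {0..1}" for t s
    by (simp add: green_kernel'_def \<alpha>_def \<beta>_def h3(2)[OF that] h4(2)[OF that] algebra_simps)
  have "is_green a lam X_P (green_kernel \<alpha> \<beta>)"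
  proof (rule is_green_X_P[OF c nr])
    fix s :: real assume s: "s \<in> {0<..<1}"
    have "green_kernel \<alpha> \<beta> 0 s - green_kernel \<alpha> \<beta> 1 s 
        = (r3 a lam 0 - r3 a lam 1) * K 1 s + (r4 a lam 0 - r4 a lam 1) * K' 1 s - K 1 s"
      using s by (simp add: k algebra_simps)
    then show "green_kernel \<alpha> \<beta> 0 s = green_kernel \<alpha> \<beta> 1 s" by (simp add: r3(2) r4(2))
    have "green_kernel' \<alpha> \<beta> 0 s - green_kernel' \<alpha> \<beta> 1 s 
        = (D (r3 a lam) 0 - D (r3 a lam) 1) * K 1 s + (D (r4 a lam) 0 - D (r4 a lam) 1) * K' 1 s - K' 1 s"
      using s by (simp add: k' algebra_simps)
    then show "green_kernel' \<alpha> \<beta> 0 s = green_kernel' \<alpha> \<beta> 1 s" by (simp add: r3(3) r4(3))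
  qed
  from green_eqI[OF this t s] k[OF t] show ?thesis by simp
qed

lemma mixed_determinant_nonzero:
  assumes nr: "nonresonant a lam X_M2"
  shows "\<psi>' 1 \<noteq> 0"
proof
  assume "\<psi>' 1 = 0"
  then have "\<psi> \<in> X_M2" by (simp add: mem_X_M2_iff[OF sol_\<psi>] \<psi>0)
  from nonresonantD(2)[OF nr sol_\<psi> this, of 0] show False by (simp add: \<psi>0)
qed

text \<open>
  For \<open>0 < s\<close> the truncated Cauchy function already vanishes at \<open>t = 0\<close>. Subtracting a multiple of \<open>\<psi>\<close>
  preserves this, and the multiple is chosen to make the derivative at \<open>t = 1\<close> vanish.
\<close>

lemma G_M2_eq:
  assumes nr: "nonresonant a lam X_M2" and t: "t \<in> {0..1}" and s: "s \<in> {0..1}"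
  shows "G_M2 a lam t s = (if s \<le> t then K t s else 0) - \<psi> t * (K' 1 s / \<psi>' 1)"
proof -
  note nz = mixed_determinant_nonzero[OF nr]
  define \<beta> where "\<beta> = (\<lambda>s. - (K' 1 s / \<psi>' 1))"
  have c: "continuous_on {0..1} \<beta>"
    unfolding \<beta>_def by (intro continuous_intros K_continuous) (use nz in simp)
  have "is_green a lam X_M2 (green_kernel (\<lambda>_. 0) \<beta>)"
    by (rule is_green_X_M2[OF _ c nr]) (use nz in \<open>auto simp: green_kernel_def green_kernel'_def \<psi>0 \<beta>_def\<close>)
  from green_eqI[OF this t s] show ?thesis by (simp add: green_kernel_def \<beta>_def)
qed

text \<open>
  For \<open>t < s\<close> the truncated Cauchy function is 0, so near \<open>t = 0\<close> only the multiple of \<open>\<psi>\<close> remains, and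
  \<open>\<psi>' 0 = 1\<close>.
\<close>

lemma dt0_G_M2:
  assumes nr: "nonresonant a lam X_M2" and s: "s \<in> {0..1}"
  shows "dt0 (G_M2 a lam) s = - (K' 1 s / \<psi>' 1)"
  unfolding dt0_def
proof (rule extend_eq_continuous[OF _ _ s])
  show "continuous_on {0..1} (\<lambda>s. - (K' 1 s / \<psi>' 1))"
    by (intro continuous_intros K_continuous) (use mixed_determinant_nonzero[OF nr] in simp)
  fix s :: real assume s: "s \<in> {0<..<1}"
  have "((\<lambda>t. \<psi> t * - (K' 1 s / \<psi>' 1)) has_real_derivative \<psi>' 0 * - (K' 1 s / \<psi>' 1)) (at 0 within {0..1})"
    by (rule DERIV_cmult_right[OF solution_derivative(1)[OF sol_\<psi>]]) simp
  then have "((\<lambda>t. G_M2 a lam t s) has_real_derivative - (K' 1 s / \<psi>' 1)) (at 0 within {0..1})"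
    unfolding \<psi>0 mult_1
    by (rule has_field_derivative_transform_within[where d=s]) (use s in \<open>auto simp: G_M2_eq[OF nr]\<close>)
  then show "D (\<lambda>t. G_M2 a lam t s) 0 = - (K' 1 s / \<psi>' 1)" by (rule D_eqI) simp
qed

text \<open>
  At \<open>s = 0\<close> the Cauchy function is \<open>\<psi>\<close>; expressing \<open>\<psi>\<close> through its jumps \<open>- \<psi> 1\<close> and \<open>1 - \<psi>' 1\<close> cancels all
  terms but one \<open>r4\<close>.
\<close>

lemma G_P_at_0:
  assumes nr: "nonresonant a lam X_P" and t: "t \<in> {0..1}"
  shows "G_P a lam t 0 = r4 a lam t"
  using homogeneous_eq_jumps[OF nr sol_\<psi> t] G_P_eq[OF nr t, of 0] t by (simp add: K_initial \<psi>0 algebra_simps)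

text \<open>
  At \<open>s = 0\<close> the functions \<open>K t\<close>, \<open>K 1\<close> and \<open>K' 1\<close> have the derivatives \<open>- \<phi> t\<close>, \<open>- \<phi> 1\<close> and
  \<open>- \<phi>' 1\<close>. Expressing \<open>\<phi> t\<close> through its jumps \<open>1 - \<phi> 1\<close> and \<open>- \<phi>' 1\<close> leaves only \<open>- r3\<close>.
\<close>

lemma ds0_G_P:
  assumes nr: "nonresonant a lam X_P" and t: "t \<in> {0..1}"
  shows "ds0 (G_P a lam) t = - r3 a lam t"
  unfolding ds0_def
proof (rule extend_eq_continuous[OF _ _ t])
  have "primitive (r3 a lam) (D (r3 a lam))" using r3_solution(1)[OF nr] by (simp add: solution_def)
  then show "continuous_on {0..1} (\<lambda>t. - r3 a lam t)" by (intro continuous_intros primitive_continuous)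
  fix t :: real assume t: "t \<in> {0<..<1}"
  have d: "(\<phi> has_real_derivative 0) (at 0 within {0..1})" "(\<psi> has_real_derivative 1) (at 0 within {0..1})"
    using solution_derivative(1)[OF sol_\<phi>, of 0] solution_derivative(1)[OF sol_\<psi>, of 0] by (simp_all add: \<phi>0 \<psi>0)
  have "((\<lambda>s. K t s + r3 a lam t * K 1 s + r4 a lam t * K' 1 s) has_real_derivative
      - \<phi> t - r3 a lam t * \<phi> 1 - r4 a lam t * \<phi>' 1) (at 0 within {0..1})"
    unfolding K_def K'_def by (rule derivative_eq_intros d refl)+ simp
  then have "((\<lambda>s. G_P a lam t s) has_real_derivative - \<phi> t - r3 a lam t * \<phi> 1 - r4 a lam t * \<phi>' 1) (at 0 within {0..1})"
    by (rule has_field_derivative_transform_within[where d=t]) (use t in \<open>auto simp: G_P_eq[OF nr]\<close>)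
  then have "D (\<lambda>s. G_P a lam t s) 0 = - \<phi> t - r3 a lam t * \<phi> 1 - r4 a lam t * \<phi>' 1" by (rule D_eqI) simp
  also have "\<dots> = - r3 a lam t"
    using homogeneous_eq_jumps[OF nr sol_\<phi>, of t] t by (simp add: \<phi>0 algebra_simps)
  finally show "D (\<lambda>s. G_P a lam t s) 0 = - r3 a lam t" .
qed

text \<open>
  The truncated Cauchy functions in the two Green's functions cancel, and what remains is \<open>\<psi>\<close> expressed
  through its jumps, multiplied by \<open>K' 1 s / \<psi>' 1\<close>.
\<close>

lemma G_M2_decomposition:
  assumes nrP: "nonresonant a lam X_P" and nrM: "nonresonant a lam X_M2"
    and t: "t \<in> {0..1}" and s: "s \<in> {0..1}"
  shows "G_M2 a lam t s = G_P a lam t s - r3 a lam t * G_M2 a lam 1 s + r4 a lam t * dt0 (G_M2 a lam) s"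
proof -
  define \<kappa> where "\<kappa> = K' 1 s / \<psi>' 1"
  have \<kappa>: "K' 1 s = \<psi>' 1 * \<kappa>" using mixed_determinant_nonzero[OF nrM] by (simp add: \<kappa>_def)
  have G1: "G_M2 a lam 1 s = K 1 s - \<psi> 1 * \<kappa>"
    using G_M2_eq[OF nrM, of 1 s] s by (simp add: \<kappa>_def)
  have d: "dt0 (G_M2 a lam) s = - \<kappa>" using dt0_G_M2[OF nrM s] by (simp add: \<kappa>_def)
  have \<psi>t: "\<psi> t = - \<psi> 1 * r3 a lam t + (1 - \<psi>' 1) * r4 a lam t"
    using homogeneous_eq_jumps[OF nrP sol_\<psi> t] by (simp add: \<psi>0)
  have "G_M2 a lam t s = (if s \<le> t then K t s else 0) - (- \<psi> 1 * r3 a lam t + (1 - \<psi>' 1) * r4 a lam t) * \<kappa>"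
    using G_M2_eq[OF nrM t s] \<psi>t by (simp add: \<kappa>_def)
  then show ?thesis
    unfolding G_P_eq[OF nrP t s] G1 d \<kappa> by (simp add: algebra_simps)
qed

end

theorem theorem3p38:
  fixes a :: "real \<Rightarrow> real" and lam t s :: real
  assumes "integrable (lebesgue_on {0..1}) a"
    and "nonresonant a lam X_P" and "nonresonant a lam X_M2"
    and "t \<in> {0..1}" and "s \<in> {0..1}"
  shows "G_M2 a lam t s =
           G_P a lam t s - r3 a lam t * G_M2 a lam 1 s + r4 a lam t * dt0 (G_M2 a lam) s
       \<and> G_P a lam t s - r3 a lam t * G_M2 a lam 1 s + r4 a lam t * dt0 (G_M2 a lam) s =
           G_P a lam t s + ds0 (G_P a lam) t * G_M2 a lam 1 s + G_P a lam t 0 * dt0 (G_M2 a lam) s"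
proof -
  note coeff = absolutely_integrable_coeff[OF assms(1), of lam]
  obtain \<phi> \<phi>' where \<phi>: "solution (\<lambda>t. a t + lam) (\<lambda>_. 0) \<phi> \<phi>'" "\<phi> 0 = 1" "\<phi>' 0 = 0"
    using solution_exists[OF coeff] by blast
  obtain \<psi> \<psi>' where \<psi>: "solution (\<lambda>t. a t + lam) (\<lambda>_. 0) \<psi> \<psi>'" "\<psi> 0 = 0" "\<psi>' 0 = 1"
    using solution_exists[OF coeff] by blast
  interpret fundamental_system a lam \<phi> \<phi>' \<psi> \<psi>'
    by unfold_locales (use assms(1) \<phi> \<psi> in auto)
  show ?thesis
    using G_M2_decomposition[OF assms(2-5)] ds0_G_P[OF assms(2,4)] G_P_at_0[OF assms(2,4)] by simp
qed

end
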